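(* There is an absolute constant $C>0$ such that the following holds for every integer $n \geq 1$ and every real $K \geq 2$. Suppose that $A \subseteq \operatorname{U}_n(\mathbb{C})$ is a $K$-approximate group. Then there is a set $B \subseteq \operatorname{U}_n(\mathbb{C})$ such that $B$ is a $K^C$-approximate subgroup of $\operatorname{U}_n(\mathbb{C})$, $B$ consists of simultaneously diagonalisable matrices, and $A$ is $n^{Cn^3}K^{Cn}$-controlled by $B$.
   Context: $\operatorname{U}_n(\mathbb{C})$ is the group of $n \times n$ complex unitary matrices. For subsets $X, Y$ of a group, $XY := \{xy : x \in X, y \in Y\}$ and $A^2 := AA$. Approximate group: let $G$ be a group and $K \geq 1$. A finite subset $A \subseteq G$ is a $K$-approximate group (or $K$-approximate subgroup of $G$) if (i) $A$ is symmetric, i.e. $a \in A$ implies $a^{-1} \in A$, and the identity lies in $A$; and (ii) there is a symmetric subset $X \subseteq G$ with $|X| \leq K$ such that $A^2 \subseteq XA$. Here $G = \operatorname{U}_n(\mathbb{C})$. Control: for subsets $A, B$ of a group $G$ and $K \geq 1$, $A$ is $K$-controlled by $B$ if $|B| \leq K|A|$ and there is a set $X \subseteq G$ with $|X| \leq K$ such that $A \subseteq XB \cap BX$. *)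

theory Defs
  imports
    "HOL-Algebra.Coset"
    "Jordan_Normal_Form.Schur_Decomposition"
begin

definition sym_subset :: "('a, 'b) monoid_scheme \<Rightarrow> 'a set \<Rightarrow> bool" where
  "sym_subset G A \<longleftrightarrow> A \<subseteq> carrier G \<and> (\<forall>a\<in>A. inv\<^bsub>G\<^esub> a \<in> A)"

definition approx_group :: "('a, 'b) monoid_scheme \<Rightarrow> real \<Rightarrow> 'a set \<Rightarrow> bool" where
  "approx_group G K A \<longleftrightarrow>
     finite A \<and> sym_subset G A \<and> \<one>\<^bsub>G\<^esub> \<in> A \<and>
     (\<exists>X. sym_subset G X \<and> finite X \<and> real (card X) \<le> K \<and> A <#>\<^bsub>G\<^esub> A \<subseteq> X <#>\<^bsub>G\<^esub> A)"

text \<open>Finiteness of \<open>B\<close> and \<open>X\<close> has to be required separately, because \<open>card\<close> is \<open>0\<close> on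
  infinite sets; the inclusion then forces \<open>A\<close> to be finite as well.\<close>

definition controlled_by :: "('a, 'b) monoid_scheme \<Rightarrow> real \<Rightarrow> 'a set \<Rightarrow> 'a set \<Rightarrow> bool" where
  "controlled_by G K A B \<longleftrightarrow>
     A \<subseteq> carrier G \<and> B \<subseteq> carrier G \<and>
     finite B \<and> real (card B) \<le> K * real (card A) \<and>
     (\<exists>X. X \<subseteq> carrier G \<and> finite X \<and> real (card X) \<le> K \<and>
          A \<subseteq> (X <#>\<^bsub>G\<^esub> B) \<inter> (B <#>\<^bsub>G\<^esub> X))"

definition unitary_group :: "nat \<Rightarrow> complex mat monoid" where
  "unitary_group n =
     \<lparr>carrier = {U \<in> carrier_mat n n. U * mat_adjoint U = 1\<^sub>m n \<and> mat_adjoint U * U = 1\<^sub>m n},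
      monoid.mult = (*),
      one = 1\<^sub>m n\<rparr>"

text \<open>The change of basis \<open>P\<close> (with inverse \<open>Q\<close>) is the same for all members of \<open>S\<close>; it is only
  required to be invertible, not unitary.\<close>

definition simultaneously_diagonalisable :: "complex mat set \<Rightarrow> bool" where
  "simultaneously_diagonalisable S \<longleftrightarrow>
     (\<exists>P Q. \<forall>M\<in>S. \<exists>D. diagonal_mat D \<and> similar_mat_wit M D P Q)"

lemma mat_adjoint_carrier: "U \<in> carrier_mat n m \<Longrightarrow> mat_adjoint U \<in> carrier_mat m n"
  by (auto simp: mat_adjoint_def)

lemma mat_adjoint_index:
  assumes "U \<in> carrier_mat n m" "i < m" "j < n"
  shows "mat_adjoint U $$ (i, j) = conjugate (U $$ (j, i))"
  using assms by (auto simp: mat_adjoint_def mat_of_rows_index)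

lemma mat_adjoint_mult:
  fixes U V :: "complex mat"
  assumes U: "U \<in> carrier_mat n n" and V: "V \<in> carrier_mat n n"
  shows "mat_adjoint (U * V) = mat_adjoint V * mat_adjoint U"
proof (rule eq_matI)
  note carr = mat_adjoint_carrier[OF U] mat_adjoint_carrier[OF V]
    mat_adjoint_carrier[OF mult_carrier_mat[OF U V]]
  fix i j assume "i < dim_row (mat_adjoint V * mat_adjoint U)"
    "j < dim_col (mat_adjoint V * mat_adjoint U)"
  then have ij: "i < n" "j < n" using carr by auto
  then show "mat_adjoint (U * V) $$ (i, j) = (mat_adjoint V * mat_adjoint U) $$ (i, j)"
    using U V carr
    by (auto simp: mat_adjoint_index[OF mult_carrier_mat[OF U V]] mat_adjoint_index[OF U]
        mat_adjoint_index[OF V] scalar_prod_def sum_conjugate mult.commute intro!: sum.cong)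
qed (use mat_adjoint_carrier[OF U] mat_adjoint_carrier[OF V]
      mat_adjoint_carrier[OF mult_carrier_mat[OF U V]] in auto)

lemma mat_adjoint_adjoint:
  fixes U :: "complex mat"
  assumes U: "U \<in> carrier_mat n n"
  shows "mat_adjoint (mat_adjoint U) = U"
  using mat_adjoint_carrier[OF U] mat_adjoint_carrier[OF mat_adjoint_carrier[OF U]] U
  by (intro eq_matI)
    (auto simp: mat_adjoint_index[OF mat_adjoint_carrier[OF U]] mat_adjoint_index[OF U])

lemma mat_adjoint_one: "mat_adjoint (1\<^sub>m n :: complex mat) = 1\<^sub>m n"
  using mat_adjoint_carrier[OF one_carrier_mat[of n]]
  by (intro eq_matI) (auto simp: mat_adjoint_index[OF one_carrier_mat])

lemma unitary_group_is_group: "group (unitary_group n)"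
proof (rule groupI)
  fix U V assume "U \<in> carrier (unitary_group n)" "V \<in> carrier (unitary_group n)"
  then have U: "U \<in> carrier_mat n n" "U * mat_adjoint U = 1\<^sub>m n" "mat_adjoint U * U = 1\<^sub>m n"
    and V: "V \<in> carrier_mat n n" "V * mat_adjoint V = 1\<^sub>m n" "mat_adjoint V * V = 1\<^sub>m n"
    by (auto simp: unitary_group_def)
  note U' = mat_adjoint_carrier[OF U(1)] and V' = mat_adjoint_carrier[OF V(1)]
  have "U * V * (mat_adjoint V * mat_adjoint U) = U * (V * mat_adjoint V) * mat_adjoint U"
    using U(1) V(1) U' V' by (simp add: assoc_mult_mat[of _ n n _ n _ n])
  moreover have "mat_adjoint V * mat_adjoint U * (U * V) = mat_adjoint V * (mat_adjoint U * U) * V"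
    using U(1) V(1) U' V' by (simp add: assoc_mult_mat[of _ n n _ n _ n])
  ultimately show "U \<otimes>\<^bsub>unitary_group n\<^esub> V \<in> carrier (unitary_group n)"
    using U V U' V' by (simp add: unitary_group_def mat_adjoint_mult)
next
  fix U assume "U \<in> carrier (unitary_group n)"
  then show "\<exists>V\<in>carrier (unitary_group n). V \<otimes>\<^bsub>unitary_group n\<^esub> U = \<one>\<^bsub>unitary_group n\<^esub>"
    by (intro bexI[of _ "mat_adjoint U"])
      (auto simp: unitary_group_def mat_adjoint_adjoint mat_adjoint_carrier)
qed (auto simp: unitary_group_def mat_adjoint_one intro: assoc_mult_mat)

lemma unitary_group_inv:
  assumes "U \<in> carrier (unitary_group n)"
  shows "inv\<^bsub>unitary_group n\<^esub> U = mat_adjoint U"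
proof -
  interpret group "unitary_group n" by (rule unitary_group_is_group)
  show ?thesis
    using assms by (intro inv_equality)
      (auto simp: unitary_group_def mat_adjoint_adjoint mat_adjoint_carrier)
qed

end

theory Submission
  imports
    Defs
    "HOL-Analysis.L2_Norm"
    "HOL-Computational_Algebra.Fundamental_Theorem_Algebra"
begin

text \<open>
  Jordan's argument for finite linear groups, adapted to approximate groups. In the Frobenius norm
  \<open>\<parallel>[s, g] - 1\<parallel> \<le> 2 \<parallel>s - 1\<parallel> \<parallel>g - 1\<parallel>\<close>. Let \<open>H\<close> be the centralizer of some commuting elements and cut
  \<open>A\<close> into pieces of small diameter, each inside one left coset of \<open>H\<close>. Quotients of elements
  of one piece lie in \<open>A\<^sup>2 \<inter> H\<close> and are close to \<open>1\<close>. If all such elements are central in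
  \<open>H\<close>, then few cosets of the centre of \<open>H\<close> cover \<open>A\<close>. Otherwise take a noncentral one, \<open>g\<close>, of
  minimal distance to \<open>1\<close>. The commutators \<open>[s, g]\<close>, for \<open>s\<close> another such element, lie in \<open>A\<^sup>8\<close>,
  which is covered by \<open>K\<^sup>7\<close> translates of \<open>A\<close>. Two of them in the same translate differ by an element
  of \<open>A\<^sup>2 \<inter> H\<close> closer to \<open>1\<close> than \<open>g\<close>, which is therefore central in \<open>H\<close>, and a trace computation shows
  that it is \<open>1\<close>. So \<open>g\<close> has at most \<open>K\<^sup>7\<close> conjugates by such \<open>s\<close>, and one may pass to the
  centralizer of \<open>g\<close> in \<open>H\<close>. Each such step refines the decomposition of the space into common
  eigenspaces, so there are fewer than \<open>n\<close> steps. The set \<open>B\<close> is \<open>A\<^sup>2 \<inter> Z\<close> for the resulting abelian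
  group \<open>Z\<close>.
\<close>

subsection \<open>Product sets and coset counting\<close>

no_notation subset_mset (infix "<#" 50)

text \<open>On \<open>A\<close> the map \<open>f\<close> factors through the label \<open>g\<close>.
  Mostly \<open>f\<close> is a coset map below, and the labels then count the cosets met by
  \<open>A\<close>.\<close>

lemma card_image_le_of_label:
  assumes "finite L" "\<And>a. a \<in> A \<Longrightarrow> g a \<in> L"
    and "\<And>a b. a \<in> A \<Longrightarrow> b \<in> A \<Longrightarrow> g a = g b \<Longrightarrow> f a = f b"
  shows "card (f ` A) \<le> card L"
proof -
  have "f ` A \<subseteq> (\<lambda>l. f (SOME a. a \<in> A \<and> g a = l)) ` (g ` A)"
  proof
    fix y assume "y \<in> f ` A"
    then obtain a where a: "a \<in> A" "y = f a" by auto
    let ?b = "SOME b. b \<in> A \<and> g b = g a"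
    have "?b \<in> A \<and> g ?b = g a" by (rule someI[of _ a]) (use a in auto)
    then have "y = f ?b" using a assms(3)[of a ?b] by auto
    then show "y \<in> (\<lambda>l. f (SOME a. a \<in> A \<and> g a = l)) ` (g ` A)" using a by auto
  qed
  moreover have gL: "g ` A \<subseteq> L" using assms(2) by auto
  moreover have fin: "finite (g ` A)" using gL assms(1) finite_subset by blast
  ultimately have "card (f ` A) \<le> card (g ` A)" by (meson surj_card_le)
  also have "\<dots> \<le> card L" using gL assms(1) by (rule card_mono[rotated])
  finally show ?thesis .
qed

definition centralizer :: "('a, 'b) monoid_scheme \<Rightarrow> 'a set \<Rightarrow> 'a set" where
  "centralizer G S = {h \<in> carrier G. \<forall>g\<in>S. h \<otimes>\<^bsub>G\<^esub> g = g \<otimes>\<^bsub>G\<^esub> h}"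

primrec set_power :: "('a, 'b) monoid_scheme \<Rightarrow> 'a set \<Rightarrow> nat \<Rightarrow> 'a set" where
  "set_power G A 0 = {\<one>\<^bsub>G\<^esub>}"
| "set_power G A (Suc m) = set_power G A m <#>\<^bsub>G\<^esub> A"

lemma set_mult_image: "A <#>\<^bsub>G\<^esub> B = (\<lambda>(a, b). a \<otimes>\<^bsub>G\<^esub> b) ` (A \<times> B)"
  by (auto simp: set_mult_def)

lemma set_mult_memI: "a \<in> A \<Longrightarrow> b \<in> B \<Longrightarrow> a \<otimes>\<^bsub>G\<^esub> b \<in> A <#>\<^bsub>G\<^esub> B"
  by (auto simp: set_mult_def)

lemma finite_set_mult: "finite A \<Longrightarrow> finite B \<Longrightarrow> finite (A <#>\<^bsub>G\<^esub> B)"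
  by (simp add: set_mult_image)

lemma card_set_mult_le:
  assumes "finite A" "finite B"
  shows "card (A <#>\<^bsub>G\<^esub> B) \<le> card A * card B"
  unfolding set_mult_image using card_image_le[OF finite_cartesian_product[OF assms]]
  by (simp add: card_cartesian_product)

context group
begin

lemma subgroup_centralizer:
  assumes S: "S \<subseteq> carrier G"
  shows "subgroup (centralizer G S) G"
proof (rule subgroupI)
  show "centralizer G S \<noteq> {}" using S by (auto simp: centralizer_def intro!: exI[of _ \<one>])
  fix a assume a: "a \<in> centralizer G S"
  then have ac: "a \<in> carrier G" by (simp add: centralizer_def)
  have "inv a \<otimes> g = g \<otimes> inv a" if g: "g \<in> S" for g
  proof -
    have gc: "g \<in> carrier G" using g S by auto
    have "g \<otimes> inv a = inv a \<otimes> (a \<otimes> g) \<otimes> inv a" using ac gc by (simp add: m_assoc[symmetric])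
    also have "a \<otimes> g = g \<otimes> a" using a g by (simp add: centralizer_def)
    also have "inv a \<otimes> (g \<otimes> a) \<otimes> inv a = inv a \<otimes> g" using ac gc by (simp add: m_assoc)
    finally show ?thesis by simp
  qed
  then show "inv a \<in> centralizer G S" using ac by (simp add: centralizer_def)
  fix b assume b: "b \<in> centralizer G S"
  then have bc: "b \<in> carrier G" by (simp add: centralizer_def)
  have "a \<otimes> b \<otimes> g = g \<otimes> (a \<otimes> b)" if g: "g \<in> S" for g
  proof -
    have gc: "g \<in> carrier G" using g S by auto
    have "a \<otimes> b \<otimes> g = a \<otimes> (g \<otimes> b)" using a b g ac bc gc by (simp add: centralizer_def m_assoc)
    also have "\<dots> = a \<otimes> g \<otimes> b" using ac bc gc by (simp add: m_assoc)
    also have "\<dots> = g \<otimes> a \<otimes> b" using a g by (simp add: centralizer_def)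
    finally show ?thesis using ac bc gc by (simp add: m_assoc)
  qed
  then show "a \<otimes> b \<in> centralizer G S" using ac bc by (simp add: centralizer_def)
qed (auto simp: centralizer_def)

lemma l_coset_eq_iff:
  assumes H: "subgroup H G" and a: "a \<in> carrier G" and b: "b \<in> carrier G"
  shows "a <# H = b <# H \<longleftrightarrow> inv a \<otimes> b \<in> H"
proof
  assume "a <# H = b <# H"
  moreover have "b \<in> b <# H"
    using b subgroup.one_closed[OF H] by (auto simp: l_coset_def intro!: bexI[of _ \<one>])
  ultimately obtain h where h: "h \<in> H" "b = a \<otimes> h" by (auto simp: l_coset_def)
  then show "inv a \<otimes> b \<in> H" using a subgroup.mem_carrier[OF H h(1)] by (simp add: m_assoc[symmetric])
next
  assume h: "inv a \<otimes> b \<in> H"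
  then have "b = a \<otimes> (inv a \<otimes> b)" using a b by (simp add: m_assoc[symmetric])
  then have "b \<in> a <# H" using h by (auto simp: l_coset_def)
  then show "a <# H = b <# H" using l_repr_independence[OF _ a H] by blast
qed

lemma set_power_closed: "A \<subseteq> carrier G \<Longrightarrow> set_power G A m \<subseteq> carrier G"
  by (induction m) (auto simp: set_mult_closed)

lemma finite_set_power: "finite A \<Longrightarrow> finite (set_power G A m)"
  by (induction m) (auto simp: finite_set_mult)

lemma set_power_1: "A \<subseteq> carrier G \<Longrightarrow> set_power G A (Suc 0) = A"
  by (force simp: set_mult_def)

lemma set_power_mult:
  assumes A: "A \<subseteq> carrier G"
  shows "set_power G A i <#> set_power G A j = set_power G A (i + j)"
proof (induction j)
  case 0
  then show ?case using set_power_closed[OF A, of i] by (force simp: set_mult_def)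
next
  case (Suc j)
  have "set_power G A i <#> set_power G A (Suc j) = set_power G A i <#> set_power G A j <#> A"
    using A set_power_closed[OF A] by (simp add: set_mult_assoc)
  then show ?case using Suc by simp
qed

lemma set_power_memI:
  assumes "A \<subseteq> carrier G" "x \<in> set_power G A i" "y \<in> set_power G A j"
  shows "x \<otimes> y \<in> set_power G A (i + j)"
  using assms set_power_mult[OF assms(1), of i j] by (auto simp: set_mult_def)

lemma set_power_inv:
  assumes A: "A \<subseteq> carrier G" and inv: "\<And>a. a \<in> A \<Longrightarrow> inv a \<in> A"
  shows "x \<in> set_power G A i \<Longrightarrow> inv x \<in> set_power G A i"
proof (induction i arbitrary: x)
  case (Suc i)
  then obtain y a where ya: "y \<in> set_power G A i" "a \<in> A" "x = y \<otimes> a" by (auto simp: set_mult_def)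
  then have "inv x = inv a \<otimes> inv y"
    using A set_power_closed[OF A, of i] by (simp add: inv_mult_group subset_iff)
  moreover have "inv a \<in> set_power G A (Suc 0)" using ya inv set_power_1[OF A] by simp
  ultimately show ?case using set_power_memI[OF A _ Suc.IH[OF ya(1)]] by fastforce
qed simp

text \<open>Each further factor \<open>A\<close> is absorbed by
  \<open>A <#> A \<subseteq> X <#> A\<close> at the price of one factor \<open>X\<close>, so
  \<open>Suc m\<close> factors cost \<open>m\<close> copies of \<open>X\<close>.\<close>

lemma set_power_cover:
  assumes A: "A \<subseteq> carrier G" and X: "X \<subseteq> carrier G" "finite X" and AX: "A <#> A \<subseteq> X <#> A"
  shows "\<exists>Y. Y \<subseteq> carrier G \<and> finite Y \<and> card Y \<le> card X ^ m \<and> set_power G A (Suc m) \<subseteq> Y <#> A"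
proof (induction m)
  case 0
  show ?case by (rule exI[of _ "{\<one>}"]) simp
next
  case (Suc m)
  then obtain Y where Y: "Y \<subseteq> carrier G" "finite Y" "card Y \<le> card X ^ m" "set_power G A (Suc m) \<subseteq> Y <#> A"
    by blast
  have "set_power G A (Suc (Suc m)) \<subseteq> Y <#> A <#> A"
    using mono_set_mult[OF Y(4) subset_refl] by simp
  also have "\<dots> = Y <#> (A <#> A)" using A Y by (simp add: set_mult_assoc)
  also have "\<dots> \<subseteq> Y <#> (X <#> A)" using mono_set_mult[OF subset_refl AX] .
  also have "\<dots> = Y <#> X <#> A" using A X Y by (simp add: set_mult_assoc)
  finally have "set_power G A (Suc (Suc m)) \<subseteq> Y <#> X <#> A" .
  moreover have "card (Y <#> X) \<le> card X ^ Suc m"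
    using order_trans[OF card_set_mult_le[OF Y(2) X(2), of G] mult_right_mono[OF Y(3), of "card X"]]
    by (simp add: mult.commute)
  moreover have "Y <#> X \<subseteq> carrier G" "finite (Y <#> X)"
    using X Y by (simp_all add: set_mult_closed finite_set_mult)
  ultimately show ?case by blast
qed

end

text \<open>The last assumption excludes nontrivial commutators \<open>z\<close> of \<open>t\<close> and \<open>g\<close> that commute with \<open>t\<close>,
  for \<open>g\<close> close to the identity.\<close>

locale contracting_group = group G for G (structure) +
  fixes d :: "'a \<Rightarrow> 'a \<Rightarrow> real"
  assumes dist_pos: "x \<in> carrier G \<Longrightarrow> y \<in> carrier G \<Longrightarrow> x \<noteq> y \<Longrightarrow> 0 < d x y"
    and dist_sym: "x \<in> carrier G \<Longrightarrow> y \<in> carrier G \<Longrightarrow> d x y = d y x"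
    and dist_triangle: "x \<in> carrier G \<Longrightarrow> y \<in> carrier G \<Longrightarrow> z \<in> carrier G \<Longrightarrow> d x z \<le> d x y + d y z"
    and dist_left: "x \<in> carrier G \<Longrightarrow> y \<in> carrier G \<Longrightarrow> u \<in> carrier G \<Longrightarrow> d (u \<otimes> x) (u \<otimes> y) = d x y"
    and dist_right: "x \<in> carrier G \<Longrightarrow> y \<in> carrier G \<Longrightarrow> u \<in> carrier G \<Longrightarrow> d (x \<otimes> u) (y \<otimes> u) = d x y"
    and dist_commutator: "s \<in> carrier G \<Longrightarrow> g \<in> carrier G \<Longrightarrow> d (s \<otimes> g) (g \<otimes> s) \<le> 2 * d s \<one> * d g \<one>"
    and commutator_rigid: "z \<in> carrier G \<Longrightarrow> t \<in> carrier G \<Longrightarrow> g \<in> carrier G \<Longrightarrow> d g \<one> < 1 \<Longrightarrow>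
      z \<otimes> t = t \<otimes> z \<Longrightarrow> t \<otimes> g = z \<otimes> g \<otimes> t \<Longrightarrow> z = \<one>"
begin

section \<open>Distances of commutators and one descent step\<close>

lemma dist_inv_mult:
  "x \<in> carrier G \<Longrightarrow> y \<in> carrier G \<Longrightarrow> d (inv x \<otimes> y) \<one> = d x y"
  using dist_left[of "inv x \<otimes> y" \<one> x] dist_sym[of x y] by (simp add: m_assoc[symmetric])

text \<open>The commutator is \<open>(s \<otimes> g) \<otimes> inv (g \<otimes> s)\<close>, so right
  invariance reduces the claim to \<open>dist_commutator\<close>.\<close>

lemma dist_commutator_one:
  assumes s: "s \<in> carrier G" and g: "g \<in> carrier G"
  shows "d (s \<otimes> g \<otimes> (inv s \<otimes> inv g)) \<one> \<le> 2 * d s \<one> * d g \<one>"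
proof -
  have "(s \<otimes> g \<otimes> (inv s \<otimes> inv g)) = (s \<otimes> g) \<otimes> inv (g \<otimes> s)" using s g by (simp add: inv_mult_group)
  moreover have "\<one> = (g \<otimes> s) \<otimes> inv (g \<otimes> s)" using s g by simp
  ultimately have "d (s \<otimes> g \<otimes> (inv s \<otimes> inv g)) \<one> = d (s \<otimes> g) (g \<otimes> s)"
    using dist_right[of "s \<otimes> g" "g \<otimes> s" "inv (g \<otimes> s)"] s g by (metis inv_closed m_closed)
  then show ?thesis using dist_commutator[OF s g] by simp
qed

text \<open>Cancelling in \<open>eq\<close> shows that \<open>t = inv s \<otimes> s'\<close>
  satisfies \<open>t \<otimes> g = z \<otimes> g \<otimes> t\<close>, since \<open>z\<close>
  commutes with everything involved; rigidity then gives \<open>z = \<one>\<close>.\<close>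

lemma commute_of_commutator_eq:
  assumes s: "s \<in> carrier G" and s': "s' \<in> carrier G" and g: "g \<in> carrier G" and z: "z \<in> carrier G"
    and near: "d g \<one> < 1"
    and comm: "z \<otimes> s = s \<otimes> z" "z \<otimes> s' = s' \<otimes> z" "z \<otimes> g = g \<otimes> z"
    and eq: "s' \<otimes> g \<otimes> (inv s' \<otimes> inv g) = s \<otimes> g \<otimes> (inv s \<otimes> inv g) \<otimes> z"
  shows "(inv s \<otimes> s') \<otimes> g = g \<otimes> (inv s \<otimes> s')"
proof -
  let ?t = "inv s \<otimes> s'"
  have sub: "subgroup (centralizer G {z}) G" using z by (intro subgroup_centralizer) auto
  have C: "s \<in> centralizer G {z}" "s' \<in> centralizer G {z}" "g \<in> centralizer G {z}"
    using comm s s' g by (auto simp: centralizer_def)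
  have "?t \<in> centralizer G {z}" using C sub by (simp add: subgroup.m_closed subgroup.m_inv_closed)
  then have tz: "z \<otimes> ?t = ?t \<otimes> z" by (simp add: centralizer_def)
  have "inv g \<in> centralizer G {z}" "inv s \<in> centralizer G {z}"
    using C sub by (simp_all add: subgroup.m_closed subgroup.m_inv_closed)
  then have gz: "inv g \<otimes> z = z \<otimes> inv g" and sz: "inv s \<otimes> z = z \<otimes> inv s" by (auto simp: centralizer_def)
  have "s' \<otimes> g = (s' \<otimes> g \<otimes> (inv s' \<otimes> inv g)) \<otimes> (g \<otimes> s')"
    using s s' g z by (simp add: m_assoc) (simp add: m_assoc[symmetric])
  also have "\<dots> = s \<otimes> g \<otimes> inv s \<otimes> (inv g \<otimes> z) \<otimes> g \<otimes> s'"
    unfolding eq using s s' g z by (simp add: m_assoc)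
  also have "\<dots> = s \<otimes> g \<otimes> (inv s \<otimes> z) \<otimes> s'"
    unfolding gz using s s' g z by (simp add: m_assoc)
  also have "\<dots> = s \<otimes> ((g \<otimes> z) \<otimes> ?t)"
    unfolding sz using s s' g z by (simp add: m_assoc)
  finally have "inv s \<otimes> (s' \<otimes> g) = inv s \<otimes> (s \<otimes> ((g \<otimes> z) \<otimes> ?t))" by simp
  then have tg: "?t \<otimes> g = z \<otimes> g \<otimes> ?t"
    using s s' g z comm(3) by (simp add: m_assoc) (simp add: m_assoc[symmetric])
  have "z = \<one>" using commutator_rigid[OF z _ g near tz tg] s s' by simp
  then show ?thesis using tg g s s' by simp
qed

text \<open>The set \<open>centralizer G (S \<union> H)\<close> is the centre of \<open>H\<close>.
  The first alternative arises when all short quotients in \<open>H\<close> are central. The second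
  brings in a noncentral \<open>g\<close> and pays \<open>card X ^ 7\<close> for the translates of
  \<open>A\<close> that its commutators can hit.\<close>

lemma index_step:
  fixes cell :: "'a \<Rightarrow> 'c"
  assumes A: "A \<subseteq> carrier G" "finite A" and sym: "\<And>a. a \<in> A \<Longrightarrow> inv a \<in> A"
    and X: "X \<subseteq> carrier G" "finite X" and AX: "A <#> A \<subseteq> X <#> A"
    and S: "S \<subseteq> carrier G" and H: "H = centralizer G S"
    and cell: "\<And>a b. a \<in> A \<Longrightarrow> b \<in> A \<Longrightarrow> cell a = cell b \<Longrightarrow> d a b \<le> 1 / 5"
  shows "card ((\<lambda>a. a <# centralizer G (S \<union> H)) ` A) \<le> card ((\<lambda>a. a <# H) ` A) * card (cell ` A) \<or>
    (\<exists>g\<in>H. (\<exists>h\<in>H. h \<otimes> g \<noteq> g \<otimes> h) \<and>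
      card ((\<lambda>a. a <# centralizer G (insert g S)) ` A)
        \<le> card ((\<lambda>a. a <# H) ` A) * card (cell ` A) * card X ^ 7)"
proof -
  have subH: "subgroup H G" unfolding H by (rule subgroup_centralizer[OF S])
  have HG: "H \<subseteq> carrier G" using subH subgroup.subset by blast
  \<comment> \<open>\<open>r a\<close> represents the piece of \<open>A\<close> containing
    \<open>a\<close>. It depends only on the coset and the cell, so elements of one piece share
    it.\<close>
  define r where "r a = (SOME b. b \<in> A \<and> b <# H = a <# H \<and> cell b = cell a)" for a
  have r: "r a \<in> A \<and> r a <# H = a <# H \<and> cell (r a) = cell a" if "a \<in> A" for a
    unfolding r_def by (rule someI[of _ a]) (use that in auto)
  have r_cong: "r a = r b" if "a <# H = b <# H" "cell a = cell b" for a b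
    unfolding r_def using that by simp
  define s where "s a = inv (r a) \<otimes> a" for a
  \<comment> \<open>With radius \<open>1 / 5\<close>, a commutator of
    \<open>g \<noteq> \<one>\<close> with an element of \<open>T\<close> is within
    \<open>2 / 5 * d g \<one>\<close> of \<open>\<one>\<close>, so a quotient of two such
    commutators is strictly closer to \<open>\<one>\<close> than \<open>g\<close>.\<close>
  define T where "T = {g \<in> set_power G A 2 \<inter> H. d g \<one> \<le> 1 / 5}"
  have A2: "inv a \<otimes> b \<in> set_power G A 2" if "a \<in> A" "b \<in> A" for a b
    using that sym set_power_memI[OF A(1), of _ "Suc 0" _ "Suc 0"] set_power_1[OF A(1)]
    by (simp add: numeral_2_eq_2)
  have sT: "s a \<in> T" if a: "a \<in> A" for a
  proof -
    have ra: "r a \<in> A" "r a <# H = a <# H" "cell (r a) = cell a" using r[OF a] by auto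
    have "s a \<in> H" unfolding s_def using l_coset_eq_iff[OF subH, of "r a" a] ra a A by auto
    moreover have "d (s a) \<one> \<le> 1 / 5"
      unfolding s_def using dist_inv_mult[of "r a" a] cell[OF ra(1) a ra(3)] subsetD[OF A(1) ra(1)] subsetD[OF A(1) a] by simp
    ultimately show ?thesis using A2[OF ra(1) a] by (auto simp: T_def s_def)
  qed
  have diff: "inv a \<otimes> b = inv (s a) \<otimes> s b" if ab: "a \<in> A" "b \<in> A" "r a = r b" for a b
  proof -
    have c: "r b \<in> carrier G" "a \<in> carrier G" "b \<in> carrier G" using ab r[OF ab(2)] A by auto
    then have "r b \<otimes> (inv (r b) \<otimes> b) = b" by (simp add: m_assoc[symmetric])
    then show ?thesis unfolding s_def ab(3) using c by (simp add: inv_mult_group m_assoc)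
  qed
  have TG: "T \<subseteq> carrier G" using HG by (auto simp: T_def)
  have SH: "centralizer G (S \<union> H) \<subseteq> H" unfolding H by (auto simp: centralizer_def)
  let ?I = "(\<lambda>a. a <# H) ` A"
  show ?thesis
  proof (cases "\<forall>g\<in>T. \<forall>h\<in>H. h \<otimes> g = g \<otimes> h")
    case True
    have sub: "subgroup (centralizer G (S \<union> H)) G" using S HG by (intro subgroup_centralizer) auto
    have TC: "T \<subseteq> centralizer G (S \<union> H)"
    proof
      fix g assume g: "g \<in> T"
      then have "g \<in> centralizer G S" by (simp add: T_def H)
      then show "g \<in> centralizer G (S \<union> H)" using True g by (auto simp: centralizer_def)
    qed
    \<comment> \<open>Every \<open>s a\<close> is central here, so a piece lies in a single coset of
      the centre.\<close>
    have "card ((\<lambda>a. a <# centralizer G (S \<union> H)) ` A) \<le> card (?I \<times> cell ` A)"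
    proof (rule card_image_le_of_label[where g = "\<lambda>a. (a <# H, cell a)"])
      fix a b assume ab: "a \<in> A" "b \<in> A" "(a <# H, cell a) = (b <# H, cell b)"
      have "r a = r b" using ab(3) by (intro r_cong) auto
      then have "inv a \<otimes> b = inv (s a) \<otimes> s b" by (rule diff[OF ab(1,2)])
      also have "\<dots> \<in> centralizer G (S \<union> H)"
        using subsetD[OF TC sT[OF ab(1)]] subsetD[OF TC sT[OF ab(2)]]
        by (intro subgroup.m_closed[OF sub] subgroup.m_inv_closed[OF sub])
      finally show "a <# centralizer G (S \<union> H) = b <# centralizer G (S \<union> H)"
        using l_coset_eq_iff[OF sub] ab A by blast
    qed (use A in auto)
    then show ?thesis by (simp add: card_cartesian_product)
  next
    case False
    let ?U = "{g \<in> T. \<exists>h\<in>H. h \<otimes> g \<noteq> g \<otimes> h}"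
    \<comment> \<open>A nearest noncentral element exists because \<open>set_power G A 2\<close> is
      finite.\<close>
    have "finite ?U" "?U \<noteq> {}"
      using False finite_set_power[OF A(2), of 2] by (auto simp: T_def)
    then have min: "arg_min_on (\<lambda>g. d g \<one>) ?U \<in> ?U"
      "\<not> (\<exists>g'\<in>?U. d g' \<one> < d (arg_min_on (\<lambda>g. d g \<one>) ?U) \<one>)"
      by (rule arg_min_if_finite)+
    define g where "g = arg_min_on (\<lambda>g. d g \<one>) ?U"
    have g: "g \<in> ?U" unfolding g_def by (rule min(1))
    have gmin: "d g \<one> \<le> d g' \<one>" if "g' \<in> ?U" for g'
      using min(2) that unfolding g_def not_less[symmetric] by blast
    have gT: "g \<in> set_power G A 2" "g \<in> H" "d g \<one> \<le> 1 / 5" "g \<in> carrier G"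
      using g HG by (auto simp: T_def)
    have "g \<noteq> \<one>" using g HG by auto
    then have gpos: "0 < d g \<one>" using dist_pos gT by blast
    \<comment> \<open>A commutator with \<open>g\<close> has four factors from
      \<open>set_power G A 2\<close>, hence lies in \<open>set_power G A 8\<close>; covering eight
      factors needs seven copies of \<open>X\<close>.\<close>
    obtain Y where Y: "finite Y" "Y \<subseteq> carrier G" "card Y \<le> card X ^ 7" "set_power G A 8 \<subseteq> Y <#> A"
      using set_power_cover[OF A(1) X AX, of 7] by auto
    define c where "c t = t \<otimes> g \<otimes> (inv t \<otimes> inv g)" for t
    have cY: "\<exists>y\<in>Y. \<exists>u\<in>A. c t = y \<otimes> u" if t: "t \<in> T" for t
    proof -
      have "t \<in> set_power G A 2" using t by (auto simp: T_def)
      then have "c t \<in> set_power G A ((2 + 2) + (2 + 2))"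
        unfolding c_def using gT(1) set_power_inv[OF A(1) sym] by (intro set_power_memI[OF A(1)]) auto
      then have "c t \<in> Y <#> A" using Y(4) by auto
      then show ?thesis unfolding set_mult_def by blast
    qed
    \<comment> \<open>\<open>\<xi> a\<close> names a translate of \<open>A\<close> containing the
      commutator of \<open>s a\<close> and \<open>g\<close>; it serves as the additional
      label.\<close>
    define \<xi> where "\<xi> a = (SOME y. y \<in> Y \<and> (\<exists>u\<in>A. c (s a) = y \<otimes> u))" for a
    have \<xi>: "\<xi> a \<in> Y \<and> (\<exists>u\<in>A. c (s a) = \<xi> a \<otimes> u)" if "a \<in> A" for a
      unfolding \<xi>_def by (rule someI_ex) (use cY[OF sT[OF that]] in blast)
    have sub: "subgroup (centralizer G (insert g S)) G" using S gT by (intro subgroup_centralizer) auto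
    have "card ((\<lambda>a. a <# centralizer G (insert g S)) ` A) \<le> card ((?I \<times> cell ` A) \<times> Y)"
    proof (rule card_image_le_of_label[where g = "\<lambda>a. ((a <# H, cell a), \<xi> a)"])
      fix a b assume ab: "a \<in> A" "b \<in> A" "((a <# H, cell a), \<xi> a) = ((b <# H, cell b), \<xi> b)"
      have "r a = r b" using ab(3) by (intro r_cong) auto
      then have ab': "inv a \<otimes> b = inv (s a) \<otimes> s b" by (rule diff[OF ab(1,2)])
      have sa: "s a \<in> H" "s a \<in> carrier G" "d (s a) \<one> \<le> 1 / 5"
        and sb: "s b \<in> H" "s b \<in> carrier G" "d (s b) \<one> \<le> 1 / 5"
        using sT[OF ab(1)] sT[OF ab(2)] HG by (auto simp: T_def)
      obtain u v where uv: "u \<in> A" "v \<in> A" "c (s a) = \<xi> a \<otimes> u" "c (s b) = \<xi> a \<otimes> v"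
        using \<xi>[OF ab(1)] \<xi>[OF ab(2)] ab(3) by (metis prod.inject)
      have y: "\<xi> a \<in> carrier G" using \<xi>[OF ab(1)] Y by auto
      define z where "z = inv (c (s a)) \<otimes> c (s b)"
      have cH: "c t \<in> H" if "t \<in> H" for t
        unfolding c_def using that gT(2)
        by (intro subgroup.m_closed[OF subH] subgroup.m_inv_closed[OF subH])
      have zH: "z \<in> H" unfolding z_def using cH[OF sa(1)] cH[OF sb(1)]
        by (intro subgroup.m_closed[OF subH] subgroup.m_inv_closed[OF subH])
      have cG: "c (s a) \<in> carrier G" "c (s b) \<in> carrier G" "z \<in> carrier G"
        using cH[OF sa(1)] cH[OF sb(1)] zH HG by blast+
      have uvG: "u \<in> carrier G" "v \<in> carrier G" using uv A by auto
      \<comment> \<open>The common translate cancels, so \<open>z\<close> is a quotient of two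
        elements of \<open>A\<close>.\<close>
      have "inv (\<xi> a) \<otimes> (\<xi> a \<otimes> v) = v" using y uvG by (simp add: m_assoc[symmetric])
      then have "z = inv u \<otimes> v"
        unfolding z_def uv(3,4) using y uvG by (simp add: inv_mult_group m_assoc)
      then have z2: "z \<in> set_power G A 2" using A2 uv by simp
      have near: "d (c t) \<one> \<le> 2 / 5 * d g \<one>" if "t \<in> carrier G" "d t \<one> \<le> 1 / 5" for t
      proof -
        have "2 * d t \<one> * d g \<one> \<le> 2 * (1 / 5) * d g \<one>"
          using that(2) gpos by (intro mult_right_mono mult_left_mono) auto
        then show ?thesis using dist_commutator_one[OF that(1) gT(4)] unfolding c_def by linarith
      qed
      have "d z \<one> = d (c (s a)) (c (s b))" unfolding z_def by (rule dist_inv_mult[OF cG(1,2)])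
      also have "\<dots> \<le> d (c (s a)) \<one> + d (c (s b)) \<one>"
        using dist_triangle[of "c (s a)" \<one> "c (s b)"] dist_sym[of \<one> "c (s b)"] cG by simp
      also have "\<dots> < d g \<one>" using near[OF sa(2,3)] near[OF sb(2,3)] gpos by linarith
      finally have zg: "d z \<one> < d g \<one>" .
      then have zT: "z \<in> T" using z2 zH gT(3) by (simp add: T_def)
      \<comment> \<open>A noncentral \<open>z\<close> would belong to \<open>?U\<close> and be
        closer to \<open>\<one>\<close> than the minimiser \<open>g\<close>.\<close>
      have zc: "z \<otimes> h = h \<otimes> z" if "h \<in> H" for h
      proof (rule ccontr)
        assume "z \<otimes> h \<noteq> h \<otimes> z"
        then have "h \<otimes> z \<noteq> z \<otimes> h" by (rule not_sym)
        then have "z \<in> ?U" using zT that by (intro CollectI conjI bexI)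
        then show False using gmin[of z] zg by linarith
      qed
      \<comment> \<open>The two commutators differ by an element central in \<open>H\<close>, which
        is the situation of \<open>commute_of_commutator_eq\<close>.\<close>
      have "c (s b) = c (s a) \<otimes> z"
        unfolding z_def using cG(1,2) by (simp add: m_assoc[symmetric])
      then have "inv (s a) \<otimes> s b \<otimes> g = g \<otimes> (inv (s a) \<otimes> s b)"
        unfolding c_def using gT(3)
        by (intro commute_of_commutator_eq[OF sa(2) sb(2) gT(4) cG(3) _ zc[OF sa(1)] zc[OF sb(1)] zc[OF gT(2)]]) simp
      moreover have "inv (s a) \<otimes> s b \<in> H"
        using sa(1) sb(1) by (intro subgroup.m_closed[OF subH] subgroup.m_inv_closed[OF subH])
      ultimately have "inv a \<otimes> b \<in> centralizer G (insert g S)"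
        unfolding ab' H centralizer_def by blast
      then show "a <# centralizer G (insert g S) = b <# centralizer G (insert g S)"
        using l_coset_eq_iff[OF sub] ab A by blast
    qed (use A Y \<xi> in auto)
    also have "\<dots> = card ?I * card (cell ` A) * card Y" by (simp add: card_cartesian_product)
    also have "\<dots> \<le> card ?I * card (cell ` A) * card X ^ 7" using Y by simp
    finally show ?thesis using g gT by blast
  qed
qed

end

section \<open>Chains of commuting noncentral elements\<close>

text \<open>The head is the newest element. Being noncentral in the centralizer of the earlier ones,
  it makes the centralizer strictly smaller.\<close>

primrec commuting_chain :: "('a, 'b) monoid_scheme \<Rightarrow> 'a list \<Rightarrow> bool" where
  "commuting_chain G [] \<longleftrightarrow> True"
| "commuting_chain G (g # gs) \<longleftrightarrow> commuting_chain G gs \<and> g \<in> centralizer G (set gs) \<and>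
     (\<exists>h\<in>centralizer G (set gs). h \<otimes>\<^bsub>G\<^esub> g \<noteq> g \<otimes>\<^bsub>G\<^esub> h)"

lemma commuting_chain_carrier: "commuting_chain G gs \<Longrightarrow> set gs \<subseteq> carrier G"
  by (induction gs) (auto simp: centralizer_def)

context contracting_group
begin

text \<open>If no such \<open>Z\<close> existed, the first alternative of \<open>index_step\<close>
  would never occur, and chains of every length could be built, against the bound
  \<open>n\<close>.\<close>

lemma index_abelian_centralizer:
  fixes cell :: "'a \<Rightarrow> 'c"
  assumes A: "A \<subseteq> carrier G" "finite A" "A \<noteq> {}" and sym: "\<And>a. a \<in> A \<Longrightarrow> inv a \<in> A"
    and X: "X \<subseteq> carrier G" "finite X" and AX: "A <#> A \<subseteq> X <#> A"
    and cell: "\<And>a b. a \<in> A \<Longrightarrow> b \<in> A \<Longrightarrow> cell a = cell b \<Longrightarrow> d a b \<le> 1 / 5"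
    and chain: "\<And>gs. commuting_chain G gs \<Longrightarrow> length gs < n"
  shows "\<exists>Z. subgroup Z G \<and> (\<forall>x\<in>Z. \<forall>y\<in>Z. x \<otimes> y = y \<otimes> x) \<and>
    card ((\<lambda>a. a <# Z) ` A) \<le> (card (cell ` A) * card X ^ 7) ^ n" (is ?goal)
proof (rule ccontr)
  assume no: "\<not> ?goal"
  define N where "N = card (cell ` A)"
  have N: "1 \<le> N" unfolding N_def using A by (simp add: Suc_leI card_gt_0_iff)
  have "X \<noteq> {}" using AX A(3) by (auto simp: set_mult_def)
  then have X1: "1 \<le> card X ^ 7" using X by (simp add: Suc_leI card_gt_0_iff)
  have "\<exists>gs. commuting_chain G gs \<and> length gs = k \<and>
      card ((\<lambda>a. a <# centralizer G (set gs)) ` A) \<le> (N * card X ^ 7) ^ k" for k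
  proof (induction k)
    case 0
    \<comment> \<open>The empty chain has the whole group as centralizer, so \<open>A\<close> meets
      one coset, matching the exponent 0.\<close>
    have "centralizer G {} = carrier G" by (simp add: centralizer_def)
    then have "card ((\<lambda>a. a <# centralizer G {}) ` A) \<le> card {()}"
      using l_coset_eq_iff[OF subgroup_self] A(1)
      by (intro card_image_le_of_label[where g = "\<lambda>_. ()"]) (auto simp: subset_iff)
    then show ?case by (intro exI[of _ "[]"]) simp
  next
    case (Suc k)
    then obtain gs where gs: "commuting_chain G gs" "length gs = k"
      and le: "card ((\<lambda>a. a <# centralizer G (set gs)) ` A) \<le> (N * card X ^ 7) ^ k" by blast
    let ?H = "centralizer G (set gs)" and ?I = "card ((\<lambda>a. a <# centralizer G (set gs)) ` A)"
    have gsG: "set gs \<subseteq> carrier G" using commuting_chain_carrier gs(1) .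
    have le': "?I * N * card X ^ 7 \<le> (N * card X ^ 7) ^ Suc k"
      using mult_right_mono[OF le, of "N * card X ^ 7"] by (simp add: mult_ac)
    consider "card ((\<lambda>a. a <# centralizer G (set gs \<union> ?H)) ` A) \<le> ?I * N"
      | g where "g \<in> ?H" "\<exists>h\<in>?H. h \<otimes> g \<noteq> g \<otimes> h"
          "card ((\<lambda>a. a <# centralizer G (insert g (set gs))) ` A) \<le> ?I * N * card X ^ 7"
      using index_step[OF A(1,2) sym X AX gsG refl cell] unfolding N_def by blast
    then show ?case
    proof cases
      case 1
      have HG: "?H \<subseteq> carrier G" by (auto simp: centralizer_def)
      have "?I * N \<le> ?I * N * card X ^ 7" using X1 by simp
      also note le'
      \<comment> \<open>The exponent is raised to the uniform value \<open>n\<close>; this needs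
        \<open>k < n\<close>, from the chain bound, and a base of at least 1.\<close>
      also have "(N * card X ^ 7) ^ Suc k \<le> (N * card X ^ 7) ^ n"
      proof (rule power_increasing)
        show "Suc k \<le> n" using chain[OF gs(1)] gs(2) by simp
        show "1 \<le> N * card X ^ 7" using mult_le_mono[OF N X1] by simp
      qed
      finally have "card ((\<lambda>a. a <# centralizer G (set gs \<union> ?H)) ` A) \<le> (N * card X ^ 7) ^ n" using 1 by simp
      moreover have "subgroup (centralizer G (set gs \<union> ?H)) G"
        using gsG HG by (intro subgroup_centralizer) auto
      moreover have "x \<otimes> y = y \<otimes> x"
        if x: "x \<in> centralizer G (set gs \<union> ?H)" and y: "y \<in> centralizer G (set gs \<union> ?H)" for x y
      proof -
        have "y \<in> ?H" using y unfolding centralizer_def by blast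
        then show ?thesis using x unfolding centralizer_def by blast
      qed
      ultimately have ?goal unfolding N_def by blast
      with no show ?thesis by blast
    next
      case 2
      then show ?thesis using gs order_trans[OF 2(3) le'] by (intro exI[of _ "g # gs"]) simp
    qed
  qed
  then show False using chain less_irrefl by metis
qed

end

section \<open>Intersecting \<open>set_power G A 2\<close> with a subgroup\<close>

context group
begin

text \<open>At most \<open>K ^ 3\<close> translates of \<open>A\<close> cover
  \<open>set_power G A 4\<close>. In each translate meeting \<open>H\<close> pick a point
  \<open>f y\<close> of \<open>H\<close>; any point of \<open>H\<close> in that translate is
  \<open>f y\<close> times a quotient of two elements of \<open>A\<close>, and this quotient lies in
  \<open>H\<close>. The factor 2 comes from making the set of chosen points symmetric.\<close>

lemma approx_group_inter_subgroup:
  assumes A: "approx_group G K A" and H: "subgroup H G"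
  shows "approx_group G (2 * K ^ 3) (set_power G A 2 \<inter> H)"
proof -
  obtain X where X: "sym_subset G X" "finite X" "real (card X) \<le> K" "A <#> A \<subseteq> X <#> A"
    using A by (auto simp: approx_group_def)
  have AG: "A \<subseteq> carrier G" "finite A" "\<one> \<in> A" and sym: "\<And>a. a \<in> A \<Longrightarrow> inv a \<in> A"
    using A by (auto simp: approx_group_def sym_subset_def)
  have HG: "H \<subseteq> carrier G" using H subgroup.subset by blast
  let ?B = "set_power G A 2 \<inter> H"
  have A1: "a \<otimes> b \<in> set_power G A 2" if "a \<in> A" "b \<in> A" for a b
    using that set_power_memI[OF AG(1), of _ "Suc 0" _ "Suc 0"] set_power_1[OF AG(1)]
    by (simp add: numeral_2_eq_2)
  obtain Y where Y: "Y \<subseteq> carrier G" "finite Y" "card Y \<le> card X ^ 3" "set_power G A 4 \<subseteq> Y <#> A"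
    using set_power_cover[OF AG(1) _ X(2,4), of 3] X(1) by (auto simp: sym_subset_def)
  define f where "f y = (SOME h. h \<in> H \<and> (\<exists>u\<in>A. h = y \<otimes> u))" for y
  define Y' where "Y' = {y \<in> Y. \<exists>h\<in>H. \<exists>u\<in>A. h = y \<otimes> u}"
  have f: "f y \<in> H \<and> (\<exists>u\<in>A. f y = y \<otimes> u)" if "y \<in> Y'" for y
    unfolding f_def by (rule someI_ex) (use that in \<open>auto simp: Y'_def\<close>)
  let ?W = "f ` Y' \<union> (\<lambda>w. inv w) ` f ` Y'"
  have fY': "finite Y'" using Y by (simp add: Y'_def)
  have fG: "f y \<in> carrier G" if "y \<in> Y'" for y using f[OF that] HG by auto
  then have "sym_subset G ?W" by (auto simp: sym_subset_def)
  moreover have "finite ?W" using fY' by simp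
  moreover have "real (card ?W) \<le> 2 * K ^ 3"
  proof -
    have c: "card Y' \<le> card X ^ 3"
      using order_trans[OF card_mono[of Y Y'] Y(3)] Y(2) by (auto simp: Y'_def)
    have "card ?W \<le> card (f ` Y') + card ((\<lambda>w. inv w) ` f ` Y')" by (rule card_Un_le)
    also have "\<dots> \<le> 2 * card (f ` Y')" using card_image_le[of "f ` Y'"] fY' by simp
    also have "\<dots> \<le> 2 * card X ^ 3" using card_image_le[OF fY', of f] c by simp
    finally have "real (card ?W) \<le> real (2 * card X ^ 3)" by (rule of_nat_mono)
    also have "\<dots> \<le> 2 * K ^ 3" using power_mono[OF X(3), of 3] by simp
    finally show ?thesis .
  qed
  moreover have "?B <#> ?B \<subseteq> ?W <#> ?B"
  proof
    fix x assume "x \<in> ?B <#> ?B"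
    then obtain a b where ab: "a \<in> ?B" "b \<in> ?B" "x = a \<otimes> b" by (auto simp: set_mult_def)
    have xH: "x \<in> H" using ab H by (auto simp: subgroup.m_closed)
    have "x \<in> set_power G A (2 + 2)" unfolding ab(3) using ab by (intro set_power_memI[OF AG(1)]) auto
    then obtain y u where yu: "y \<in> Y" "u \<in> A" "x = y \<otimes> u" using Y(4) by (auto simp: set_mult_def)
    then have yY': "y \<in> Y'" using xH by (auto simp: Y'_def)
    then obtain v where v: "v \<in> A" "f y = y \<otimes> v" "f y \<in> H" using f by blast
    have c: "y \<in> carrier G" "u \<in> carrier G" "v \<in> carrier G" using yu v Y AG by auto
    have "inv v \<otimes> u = inv (f y) \<otimes> x"
      unfolding v(2) yu(3) using c by (simp add: inv_mult_group m_assoc) (simp add: m_assoc[symmetric])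
    then have "inv v \<otimes> u \<in> H" using v(3) xH H by (simp add: subgroup.m_closed subgroup.m_inv_closed)
    then have "inv v \<otimes> u \<in> ?B" using A1[OF sym[OF v(1)] yu(2)] by simp
    moreover have "x = f y \<otimes> (inv v \<otimes> u)"
      unfolding v(2) yu(3) using c by (simp add: m_assoc) (simp add: m_assoc[symmetric])
    ultimately show "x \<in> ?W <#> ?B" using yY' by (auto simp: set_mult_def)
  qed
  moreover have "finite ?B" using finite_set_power[OF AG(2)] by simp
  moreover have "sym_subset G ?B"
    using set_power_inv[OF AG(1) sym] HG H by (auto simp: sym_subset_def subgroup.m_inv_closed)
  moreover have "\<one> \<in> ?B" using A1[OF AG(3) AG(3)] H by (simp add: subgroup.one_closed)
  ultimately show ?thesis unfolding approx_group_def by - (intro conjI exI[of _ ?W]; assumption)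
qed

text \<open>The covering set consists of one representative in \<open>A\<close> for each coset of
  \<open>H\<close> met by \<open>A\<close>, together with the inverses, hence the factor 2. The size
  of the intersection is bounded through \<open>A <#> A \<subseteq> X <#> A\<close>.\<close>

lemma controlled_by_inter_subgroup:
  assumes A: "approx_group G K A" and H: "subgroup H G"
    and K: "K \<le> L" and index: "2 * real (card ((\<lambda>a. a <# H) ` A)) \<le> L"
  shows "controlled_by G L A (set_power G A 2 \<inter> H)"
proof -
  obtain X where X: "sym_subset G X" "finite X" "real (card X) \<le> K" "A <#> A \<subseteq> X <#> A"
    using A by (auto simp: approx_group_def)
  have AG: "A \<subseteq> carrier G" "finite A" and sym: "\<And>a. a \<in> A \<Longrightarrow> inv a \<in> A"
    using A by (auto simp: approx_group_def sym_subset_def)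
  have HG: "H \<subseteq> carrier G" using H subgroup.subset by blast
  let ?B = "set_power G A 2 \<inter> H"
  have A2: "set_power G A 2 = A <#> A" using set_power_1[OF AG(1)] by (simp add: numeral_2_eq_2)
  have "card ?B \<le> card (X <#> A)"
    using X AG A2 by (intro card_mono finite_set_mult) auto
  also have "\<dots> \<le> card X * card A" by (rule card_set_mult_le[OF X(2) AG(2)])
  finally have "real (card ?B) \<le> real (card X) * real (card A)" by (simp flip: of_nat_mult)
  also have "\<dots> \<le> L * real (card A)" using X(3) K by (intro mult_right_mono) auto
  finally have cB: "real (card ?B) \<le> L * real (card A)" .
  define r where "r a = (SOME b. b \<in> A \<and> b <# H = a <# H)" for a
  have r: "r a \<in> A \<and> r a <# H = a <# H" if "a \<in> A" for a
    unfolding r_def by (rule someI[of _ a]) (use that in auto)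
  have rB: "inv (r a) \<otimes> a \<in> ?B" if a: "a \<in> A" for a
  proof -
    have "inv (r a) \<otimes> a \<in> H" using l_coset_eq_iff[OF H, of "r a" a] r[OF a] a AG by auto
    then show ?thesis unfolding A2 using r[OF a] a sym by (auto simp: set_mult_def)
  qed
  have cancel: "r a \<otimes> (inv (r a) \<otimes> a) = a" if a: "a \<in> A" for a
    using r[OF a] a AG by (simp add: m_assoc[symmetric] subset_iff)
  let ?W = "r ` A \<union> (\<lambda>w. inv w) ` r ` A"
  have "card (r ` A) \<le> card ((\<lambda>a. a <# H) ` A)"
    by (rule card_image_le_of_label[where g = "\<lambda>a. a <# H"]) (use AG in \<open>auto simp: r_def\<close>)
  moreover have "card ?W \<le> card (r ` A) + card (r ` A)"
    using card_Un_le[of "r ` A" "(\<lambda>w. inv w) ` r ` A"] card_image_le[of "r ` A" "\<lambda>w. inv w"] AG by simp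
  ultimately have cW: "real (card ?W) \<le> L" using index by linarith
  have "A \<subseteq> ?W <#> ?B"
  proof
    fix a assume a: "a \<in> A"
    then have "r a \<in> ?W" by blast
    then have "r a \<otimes> (inv (r a) \<otimes> a) \<in> ?W <#> ?B" using rB[OF a] by (rule set_mult_memI)
    then show "a \<in> ?W <#> ?B" using cancel[OF a] by simp
  qed
  \<comment> \<open>Apply the previous factorisation to \<open>inv a\<close> and invert.\<close>
  moreover have "A \<subseteq> ?B <#> ?W"
  proof
    fix a assume a: "a \<in> A"
    let ?a = "inv a" and ?b = "inv (r (inv a)) \<otimes> inv a"
    have a': "?a \<in> A" using sym a .
    have c: "a \<in> carrier G" "r ?a \<in> carrier G" using a r[OF a'] AG by auto
    have "inv ?b \<in> ?B"
      using rB[OF a'] set_power_inv[OF AG(1) sym] H by (auto simp: subgroup.m_inv_closed)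
    moreover have "inv (r ?a) \<in> ?W" using a' by blast
    ultimately have "inv ?b \<otimes> inv (r ?a) \<in> ?B <#> ?W" by (rule set_mult_memI)
    moreover have "a = inv ?b \<otimes> inv (r ?a)" using c by (simp add: inv_mult_group m_assoc)
    ultimately show "a \<in> ?B <#> ?W" by simp
  qed
  ultimately have "A \<subseteq> (?W <#> ?B) \<inter> (?B <#> ?W)" by (rule Int_greatest)
  moreover have "?W \<subseteq> carrier G" using r AG by auto
  moreover have "finite ?W" using AG by simp
  moreover have "finite ?B" using finite_set_power[OF AG(2)] by simp
  moreover have "?B \<subseteq> carrier G" using HG by auto
  ultimately show ?thesis
    unfolding controlled_by_def using AG(1) cB cW by - (intro conjI exI[of _ ?W]; assumption)
qed

end

subsection \<open>The Frobenius norm on the unitary group\<close>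

text \<open>Writing the Frobenius norm as an \<open>L2_set\<close> over index pairs makes the
  Minkowski and Cauchy-Schwarz inequalities available.\<close>

definition frob_norm :: "complex mat \<Rightarrow> real" where
  "frob_norm M = L2_set (\<lambda>(i, j). cmod (M $$ (i, j))) ({..<dim_row M} \<times> {..<dim_col M})"

definition mat_trace :: "complex mat \<Rightarrow> complex" where
  "mat_trace M = (\<Sum>i<dim_row M. M $$ (i, i))"

lemma frob_norm_carrier:
  "M \<in> carrier_mat n m \<Longrightarrow> frob_norm M = L2_set (\<lambda>(i, j). cmod (M $$ (i, j))) ({..<n} \<times> {..<m})"
  by (simp add: frob_norm_def)

lemma frob_norm_nonneg: "0 \<le> frob_norm M"
  by (simp add: frob_norm_def L2_set_nonneg)

lemma frob_norm_power2:
  "M \<in> carrier_mat n m \<Longrightarrow> frob_norm M ^ 2 = (\<Sum>i<n. \<Sum>j<m. cmod (M $$ (i, j)) ^ 2)"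
  by (simp add: frob_norm_def L2_set_def sum_nonneg sum.cartesian_product split_def)

lemma frob_norm_eq_0:
  assumes "M \<in> carrier_mat n m" "frob_norm M = 0"
  shows "M = 0\<^sub>m n m"
proof -
  have "\<forall>x\<in>{..<n} \<times> {..<m}. (case x of (i, j) \<Rightarrow> cmod (M $$ (i, j))) = 0"
    using assms by (subst (asm) frob_norm_carrier) (auto simp: L2_set_eq_0_iff)
  then show ?thesis using assms(1) by (intro eq_matI) auto
qed

lemma frob_norm_add:
  assumes "A \<in> carrier_mat n m" "B \<in> carrier_mat n m"
  shows "frob_norm (A + B) \<le> frob_norm A + frob_norm B"
proof -
  have "frob_norm (A + B) \<le> L2_set (\<lambda>x. (case x of (i, j) \<Rightarrow> cmod (A $$ (i, j))) +
      (case x of (i, j) \<Rightarrow> cmod (B $$ (i, j)))) ({..<n} \<times> {..<m})"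
    unfolding frob_norm_carrier[OF add_carrier_mat[OF assms(2)], of A]
    using assms by (intro L2_set_mono) (auto simp: norm_triangle_ineq)
  also have "\<dots> \<le> frob_norm A + frob_norm B"
    unfolding frob_norm_carrier[OF assms(1)] frob_norm_carrier[OF assms(2)] by (rule L2_set_triangle_ineq)
  finally show ?thesis .
qed

lemma frob_norm_minus_commute:
  assumes "A \<in> carrier_mat n m" "B \<in> carrier_mat n m"
  shows "frob_norm (A - B) = frob_norm (B - A)"
  unfolding frob_norm_carrier[OF minus_carrier_mat[OF assms(2)], of A]
    frob_norm_carrier[OF minus_carrier_mat[OF assms(1)], of B]
  using assms by (intro L2_set_cong) (auto simp: norm_minus_commute)

lemma frob_norm_diff_triangle:
  assumes "A \<in> carrier_mat n m" "B \<in> carrier_mat n m" "C \<in> carrier_mat n m"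
  shows "frob_norm (A - C) \<le> frob_norm (A - B) + frob_norm (B - C)"
proof -
  have "A - C = (A - B) + (B - C)" using assms by (intro eq_matI) auto
  then show ?thesis using frob_norm_add[of "A - B" n m "B - C"] assms by (simp add: minus_carrier_mat)
qed

lemma frob_norm_diff:
  assumes "A \<in> carrier_mat n m" "B \<in> carrier_mat n m"
  shows "frob_norm (A - B) \<le> frob_norm A + frob_norm B"
proof -
  have "A - 0\<^sub>m n m = A" "0\<^sub>m n m - B = - B" "B - 0\<^sub>m n m = B" using assms by auto
  then show ?thesis
    using frob_norm_diff_triangle[OF assms(1) zero_carrier_mat assms(2)]
      frob_norm_minus_commute[OF assms(2) zero_carrier_mat] by simp
qed

text \<open>Cauchy-Schwarz bounds each entry of the product by the norm of a row of \<open>A\<close>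
  times the norm of a column of \<open>B\<close>; the sum of the squares then factors.\<close>

lemma frob_norm_mult:
  assumes A: "A \<in> carrier_mat n n" and B: "B \<in> carrier_mat n n"
  shows "frob_norm (A * B) \<le> frob_norm A * frob_norm B"
proof (rule power2_le_imp_le)
  define r where "r i = L2_set (\<lambda>k. cmod (A $$ (i, k))) {..<n}" for i
  define c where "c j = L2_set (\<lambda>k. cmod (B $$ (k, j))) {..<n}" for j
  have entry: "cmod ((A * B) $$ (i, j)) ^ 2 \<le> r i ^ 2 * c j ^ 2" if "i < n" "j < n" for i j
  proof -
    have "cmod ((A * B) $$ (i, j)) = cmod (\<Sum>k<n. A $$ (i, k) * B $$ (k, j))"
      using that A B by (simp add: scalar_prod_def atLeast0LessThan)
    also have "\<dots> \<le> (\<Sum>k<n. \<bar>cmod (A $$ (i, k))\<bar> * \<bar>cmod (B $$ (k, j))\<bar>)"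
      by (rule order_trans[OF norm_sum]) (simp add: norm_mult)
    also have "\<dots> \<le> r i * c j" unfolding r_def c_def by (rule L2_set_mult_ineq)
    finally show ?thesis using power_mono[of _ "r i * c j" 2] by (simp add: power_mult_distrib)
  qed
  have "frob_norm (A * B) ^ 2 \<le> (\<Sum>i<n. \<Sum>j<n. r i ^ 2 * c j ^ 2)"
    unfolding frob_norm_power2[OF mult_carrier_mat[OF A B]] using entry by (intro sum_mono) auto
  also have "\<dots> = (\<Sum>i<n. r i ^ 2) * (\<Sum>j<n. c j ^ 2)" by (simp add: sum_product)
  also have "(\<Sum>i<n. r i ^ 2) = frob_norm A ^ 2"
    unfolding frob_norm_power2[OF A] r_def by (simp add: L2_set_def sum_nonneg)
  also have "(\<Sum>j<n. c j ^ 2) = frob_norm B ^ 2"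
    unfolding frob_norm_power2[OF B] c_def by (subst sum.swap) (simp add: L2_set_def sum_nonneg)
  finally show "frob_norm (A * B) ^ 2 \<le> (frob_norm A * frob_norm B) ^ 2" by (simp add: power_mult_distrib)
qed (simp add: frob_norm_nonneg)

section \<open>The trace and its inner product\<close>

lemma mat_trace_mult_commute:
  assumes A: "A \<in> carrier_mat n n" and B: "B \<in> carrier_mat n n"
  shows "mat_trace (A * B) = mat_trace (B * A)"
proof -
  have "mat_trace (A * B) = (\<Sum>i<n. \<Sum>k<n. A $$ (i, k) * B $$ (k, i))"
    using A B by (simp add: mat_trace_def scalar_prod_def atLeast0LessThan)
  also have "\<dots> = (\<Sum>i<n. \<Sum>k<n. B $$ (i, k) * A $$ (k, i))"
    by (subst sum.swap) (simp add: mult.commute)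
  also have "\<dots> = mat_trace (B * A)"
    using A B by (simp add: mat_trace_def scalar_prod_def atLeast0LessThan)
  finally show ?thesis .
qed

lemma mat_trace_minus:
  assumes A: "A \<in> carrier_mat n n" and B: "B \<in> carrier_mat n n"
  shows "mat_trace (A - B) = mat_trace A - mat_trace B"
  using A B by (simp add: mat_trace_def sum_subtractf)

text \<open>This is the inner product that induces \<open>frob_norm\<close>; through it trace
  identities become norm statements.\<close>

lemma mat_trace_adjoint_mult:
  assumes A: "A \<in> carrier_mat n n" and B: "B \<in> carrier_mat n n"
  shows "mat_trace (mat_adjoint A * B) = (\<Sum>i<n. \<Sum>j<n. cnj (A $$ (i, j)) * B $$ (i, j))"
proof -
  have "mat_trace (mat_adjoint A * B) = (\<Sum>j<n. \<Sum>i<n. cnj (A $$ (i, j)) * B $$ (i, j))"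
    using A B mat_adjoint_carrier[OF A]
    by (simp add: mat_trace_def scalar_prod_def atLeast0LessThan mat_adjoint_index[OF A])
  then show ?thesis by (subst sum.swap)
qed

lemma mat_trace_adjoint_self:
  assumes A: "A \<in> carrier_mat n n"
  shows "mat_trace (mat_adjoint A * A) = of_real (frob_norm A ^ 2)"
  unfolding mat_trace_adjoint_mult[OF A A] frob_norm_power2[OF A]
  by (simp add: complex_norm_square mult.commute del: of_real_power)

lemma mat_trace_Cauchy_Schwarz:
  assumes A: "A \<in> carrier_mat n n" and B: "B \<in> carrier_mat n n"
  shows "cmod (mat_trace (mat_adjoint A * B)) \<le> frob_norm A * frob_norm B"
proof -
  have "cmod (mat_trace (mat_adjoint A * B)) \<le>
      (\<Sum>x\<in>{..<n} \<times> {..<n}. \<bar>case x of (i, j) \<Rightarrow> cmod (A $$ (i, j))\<bar> * \<bar>case x of (i, j) \<Rightarrow> cmod (B $$ (i, j))\<bar>)"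
    unfolding mat_trace_adjoint_mult[OF A B] sum.cartesian_product
    by (rule order_trans[OF norm_sum]) (auto simp: norm_mult split_def)
  also have "\<dots> \<le> frob_norm A * frob_norm B"
    unfolding frob_norm_carrier[OF A] frob_norm_carrier[OF B] by (rule L2_set_mult_ineq)
  finally show ?thesis .
qed

section \<open>Unitary invariance and commutators\<close>

text \<open>The product \<open>mat_adjoint (U * A) * (U * A)\<close> collapses to
  \<open>mat_adjoint A * A\<close>, whose trace is the squared norm.\<close>

lemma frob_norm_unitary_left:
  assumes U: "U \<in> carrier (unitary_group n)" and A: "A \<in> carrier_mat n n"
  shows "frob_norm (U * A) = frob_norm A"
proof -
  have U': "U \<in> carrier_mat n n" "mat_adjoint U * U = 1\<^sub>m n" using U by (auto simp: unitary_group_def)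
  note c = mat_adjoint_carrier[OF U'(1)] mat_adjoint_carrier[OF A]
  have "mat_adjoint (U * A) * (U * A) = mat_adjoint A * (mat_adjoint U * U) * A"
    using U'(1) A c by (simp add: mat_adjoint_mult assoc_mult_mat[of _ n n _ n _ n])
  also have "\<dots> = mat_adjoint A * A" using U' A c by simp
  finally have "complex_of_real (frob_norm (U * A) ^ 2) = of_real (frob_norm A ^ 2)"
    using mat_trace_adjoint_self U' A by (metis mult_carrier_mat)
  then have "frob_norm (U * A) ^ 2 = frob_norm A ^ 2" using of_real_eq_iff by blast
  then show ?thesis using frob_norm_nonneg power2_eq_iff_nonneg by blast
qed

text \<open>Here the factors \<open>U\<close> and \<open>mat_adjoint U\<close> sit at opposite ends;
  cyclicity of the trace brings them together.\<close>

lemma frob_norm_unitary_right: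
  assumes U: "U \<in> carrier (unitary_group n)" and A: "A \<in> carrier_mat n n"
  shows "frob_norm (A * U) = frob_norm A"
proof -
  have U': "U \<in> carrier_mat n n" "U * mat_adjoint U = 1\<^sub>m n" using U by (auto simp: unitary_group_def)
  note c = mat_adjoint_carrier[OF U'(1)] mat_adjoint_carrier[OF A]
  have "mat_trace (mat_adjoint (A * U) * (A * U)) = mat_trace (mat_adjoint U * (mat_adjoint A * (A * U)))"
    using U' A c by (simp add: mat_adjoint_mult assoc_mult_mat[of _ n n _ n _ n])
  also have "\<dots> = mat_trace (mat_adjoint A * (A * U) * mat_adjoint U)"
    using U' A c by (intro mat_trace_mult_commute) auto
  also have "mat_adjoint A * (A * U) * mat_adjoint U = mat_adjoint A * A * (U * mat_adjoint U)"
    using U'(1) A c by (simp add: assoc_mult_mat[of _ n n _ n _ n])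
  also have "\<dots> = mat_adjoint A * A" using U' A c by simp
  finally have "complex_of_real (frob_norm (A * U) ^ 2) = of_real (frob_norm A ^ 2)"
    using mat_trace_adjoint_self U' A by (metis mult_carrier_mat)
  then have "frob_norm (A * U) ^ 2 = frob_norm A ^ 2" using of_real_eq_iff by blast
  then show ?thesis using frob_norm_nonneg power2_eq_iff_nonneg by blast
qed

text \<open>Subtracting the identity does not change a commutator:
  \<open>A * B - B * A = ?a * ?b - ?b * ?a\<close>. Submultiplicativity then gives the factor
  2.\<close>

lemma frob_norm_commutator:
  assumes A: "A \<in> carrier_mat n n" and B: "B \<in> carrier_mat n n"
  shows "frob_norm (A * B - B * A) \<le> 2 * frob_norm (A - 1\<^sub>m n) * frob_norm (B - 1\<^sub>m n)"
proof -
  let ?a = "A - 1\<^sub>m n" and ?b = "B - 1\<^sub>m n"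
  have c: "?a \<in> carrier_mat n n" "?b \<in> carrier_mat n n" "A * B \<in> carrier_mat n n" "B * A \<in> carrier_mat n n"
    using A B by auto
  have "?a * ?b = (A * B - B) - (A - 1\<^sub>m n)"
    using A B c by (simp add: minus_mult_distrib_mat[of _ n n] mult_minus_distrib_mat[of _ n n])
  moreover have "?b * ?a = (B * A - A) - (B - 1\<^sub>m n)"
    using A B c by (simp add: minus_mult_distrib_mat[of _ n n] mult_minus_distrib_mat[of _ n n])
  ultimately have "A * B - B * A = ?a * ?b - ?b * ?a"
    using A B c by (intro eq_matI) auto
  then have "frob_norm (A * B - B * A) \<le> frob_norm (?a * ?b) + frob_norm (?b * ?a)"
    using frob_norm_diff[of "?a * ?b" n n "?b * ?a"] c by simp
  also have "\<dots> \<le> 2 * frob_norm ?a * frob_norm ?b"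
    using frob_norm_mult[OF c(1,2)] frob_norm_mult[OF c(2,1)] by (simp add: mult.commute[of "frob_norm ?b"])
  finally show ?thesis .
qed

text \<open>Put \<open>D = Z - 1\<close> and let \<open>E\<close> be its adjoint. As \<open>E\<close> commutes with \<open>T\<close>, the conjugate
  \<open>Z * G\<close> of \<open>G\<close> by \<open>T\<close> satisfies \<open>tr (E * Z * G) = tr (E * G)\<close>, so \<open>tr (E * D * G) = 0\<close>. As \<open>G\<close>
  is close to the identity, this forces \<open>D = 0\<close>.\<close>

lemma unitary_commutator_rigid:
  assumes Z: "Z \<in> carrier (unitary_group n)" and T: "T \<in> carrier (unitary_group n)"
    and G: "G \<in> carrier_mat n n" and near: "frob_norm (G - 1\<^sub>m n) < 1"
    and ZT: "Z * T = T * Z" and TG: "T * G = Z * G * T"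
  shows "Z = 1\<^sub>m n"
proof -
  define D where "D = Z - 1\<^sub>m n"
  define E where "E = mat_adjoint D"
  have Zc: "Z \<in> carrier_mat n n" "mat_adjoint Z * Z = 1\<^sub>m n" "Z * mat_adjoint Z = 1\<^sub>m n"
    and Tc: "T \<in> carrier_mat n n" "T * mat_adjoint T = 1\<^sub>m n" "mat_adjoint T * T = 1\<^sub>m n"
    using Z T by (auto simp: unitary_group_def)
  note c = mat_adjoint_carrier[OF Zc(1)] mat_adjoint_carrier[OF Tc(1)] Zc(1) Tc(1) G
  note assoc = assoc_mult_mat[of _ n n _ n _ n]
  have D: "D \<in> carrier_mat n n" by (simp add: D_def minus_carrier_mat)
  then have E: "E \<in> carrier_mat n n" by (simp add: E_def mat_adjoint_carrier)
  have Eeq: "E = mat_adjoint Z - 1\<^sub>m n"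
    unfolding E_def using c D E[unfolded E_def]
    by (intro eq_matI) (auto simp: mat_adjoint_index[OF D[unfolded D_def]] mat_adjoint_index[OF Zc(1)] D_def)
  \<comment> \<open>Multiplying \<open>Z * T = T * Z\<close> by the inverse of \<open>Z\<close> on
    both sides shows that \<open>mat_adjoint Z\<close> commutes with \<open>T\<close>.\<close>
  have "mat_adjoint Z * T = mat_adjoint Z * T * (Z * mat_adjoint Z)" using c Zc by simp
  also have "\<dots> = mat_adjoint Z * (T * Z) * mat_adjoint Z" using c by (simp add: assoc)
  also have "\<dots> = mat_adjoint Z * Z * T * mat_adjoint Z" unfolding ZT[symmetric] using c by (simp add: assoc)
  also have "\<dots> = T * mat_adjoint Z" using c Zc by simp
  finally have ET: "E * T = T * E"
    unfolding Eeq using c by (simp add: minus_mult_distrib_mat[of _ n n] mult_minus_distrib_mat[of _ n n])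
  have "Z * G = Z * G * (T * mat_adjoint T)" using c Tc by simp
  also have "\<dots> = T * (G * mat_adjoint T)"
    using c arg_cong[OF TG, of "\<lambda>M. M * mat_adjoint T"] by (simp add: assoc)
  finally have "mat_trace (E * (Z * G)) = mat_trace (E * T * (G * mat_adjoint T))"
    using c E by (simp add: assoc)
  also have "\<dots> = mat_trace (T * (E * (G * mat_adjoint T)))" unfolding ET using c E by (simp add: assoc)
  also have "\<dots> = mat_trace (E * (G * mat_adjoint T) * T)"
    using c E by (intro mat_trace_mult_commute) auto
  also have "E * (G * mat_adjoint T) * T = E * G * (mat_adjoint T * T)" using c E by (simp add: assoc)
  also have "\<dots> = E * G" using c E Tc by simp
  finally have tr: "mat_trace (E * (Z * G)) = mat_trace (E * G)" .
  have "D * G = Z * G - G" unfolding D_def using c by (simp add: minus_mult_distrib_mat[of _ n n])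
  then have "D * (G - 1\<^sub>m n) = (Z * G - G) - D"
    using D c by (simp add: mult_minus_distrib_mat[of _ n n])
  then have "E * (D * (G - 1\<^sub>m n)) = (E * (Z * G) - E * G) - E * D"
    using c D E by (simp add: mult_minus_distrib_mat[of _ n n _ n] minus_carrier_mat)
  then have "mat_trace (E * (D * (G - 1\<^sub>m n))) = - mat_trace (E * D)"
    using c D E tr by (simp add: mat_trace_minus[of _ n] minus_carrier_mat)
  \<comment> \<open>The left side is the square of \<open>frob_norm D\<close>; it gets bounded by
    itself times \<open>frob_norm (G - 1\<^sub>m n)\<close>, which is below 1.\<close>
  then have "cmod (mat_trace (E * D)) = cmod (mat_trace (E * (D * (G - 1\<^sub>m n))))" by simp
  also have "\<dots> \<le> frob_norm D * frob_norm (D * (G - 1\<^sub>m n))"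
    unfolding E_def using D by (intro mat_trace_Cauchy_Schwarz) (auto intro: minus_carrier_mat)
  also have "\<dots> \<le> frob_norm D * (frob_norm D * frob_norm (G - 1\<^sub>m n))"
    using D by (intro mult_left_mono frob_norm_mult frob_norm_nonneg) (auto intro: minus_carrier_mat)
  finally have le: "frob_norm D ^ 2 \<le> frob_norm D ^ 2 * frob_norm (G - 1\<^sub>m n)"
    unfolding E_def mat_trace_adjoint_self[OF D] norm_of_real by (simp add: power2_eq_square mult.assoc)
  have "frob_norm D = 0"
  proof (rule ccontr)
    assume "frob_norm D \<noteq> 0"
    then have "0 < frob_norm D ^ 2" by simp
    then have "frob_norm D ^ 2 * frob_norm (G - 1\<^sub>m n) < frob_norm D ^ 2 * 1"
      using near by (intro mult_strict_left_mono)
    then show False using le by simp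
  qed
  then have "D = 0\<^sub>m n n" using frob_norm_eq_0 D by blast
  then have "D $$ (i, j) = 0" if "i < n" "j < n" for i j using that by simp
  then show ?thesis using Zc(1) by (intro eq_matI) (auto simp: D_def)
qed

section \<open>The unitary group as a contracting group\<close>

lemma unitary_group_simps:
  "monoid.mult (unitary_group n) = (*)" "one (unitary_group n) = 1\<^sub>m n"
  by (simp_all add: unitary_group_def)

lemma unitary_carrier_mat: "U \<in> carrier (unitary_group n) \<Longrightarrow> U \<in> carrier_mat n n"
  by (simp add: unitary_group_def)

lemma contracting_unitary_group:
  "contracting_group (unitary_group n) (\<lambda>x y. frob_norm (x - y))"
proof (rule contracting_group.intro[OF unitary_group_is_group], unfold_locales)
  note carr = unitary_carrier_mat[where n = n]
  fix x y assume xy: "x \<in> carrier (unitary_group n)" "y \<in> carrier (unitary_group n)"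
  show "frob_norm (x - y) = frob_norm (y - x)"
    using frob_norm_minus_commute carr[OF xy(1)] carr[OF xy(2)] by blast
  show "frob_norm (x \<otimes>\<^bsub>unitary_group n\<^esub> y - y \<otimes>\<^bsub>unitary_group n\<^esub> x)
      \<le> 2 * frob_norm (x - \<one>\<^bsub>unitary_group n\<^esub>) * frob_norm (y - \<one>\<^bsub>unitary_group n\<^esub>)"
    unfolding unitary_group_simps using frob_norm_commutator carr[OF xy(1)] carr[OF xy(2)] by blast
  show "0 < frob_norm (x - y)" if "x \<noteq> y"
  proof (rule ccontr)
    assume "\<not> 0 < frob_norm (x - y)"
    then have "x - y = 0\<^sub>m n n"
      using frob_norm_eq_0[of "x - y" n n] frob_norm_nonneg[of "x - y"] minus_carrier_mat[OF carr[OF xy(2)], of x] by simp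
    then have "(x - y) $$ (i, j) = 0" if "i < n" "j < n" for i j using that by simp
    then have "x = y" using carr[OF xy(1)] carr[OF xy(2)] by (intro eq_matI) auto
    with that show False by simp
  qed
  fix z assume z: "z \<in> carrier (unitary_group n)"
  show "frob_norm (x - z) \<le> frob_norm (x - y) + frob_norm (y - z)"
    using frob_norm_diff_triangle carr[OF xy(1)] carr[OF xy(2)] carr[OF z] by blast
  have "z * x - z * y = z * (x - y)"
    using carr[OF xy(1)] carr[OF xy(2)] carr[OF z] by (simp add: mult_minus_distrib_mat[of _ n n])
  then show "frob_norm (z \<otimes>\<^bsub>unitary_group n\<^esub> x - z \<otimes>\<^bsub>unitary_group n\<^esub> y) = frob_norm (x - y)"
    unfolding unitary_group_simps using frob_norm_unitary_left[OF z] minus_carrier_mat[OF carr[OF xy(2)]] by simp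
  have "x * z - y * z = (x - y) * z"
    using carr[OF xy(1)] carr[OF xy(2)] carr[OF z] by (simp add: minus_mult_distrib_mat[of _ n n])
  then show "frob_norm (x \<otimes>\<^bsub>unitary_group n\<^esub> z - y \<otimes>\<^bsub>unitary_group n\<^esub> z) = frob_norm (x - y)"
    unfolding unitary_group_simps using frob_norm_unitary_right[OF z] minus_carrier_mat[OF carr[OF xy(2)]] by simp
  show "x = \<one>\<^bsub>unitary_group n\<^esub>" if "frob_norm (z - \<one>\<^bsub>unitary_group n\<^esub>) < 1"
    "x \<otimes>\<^bsub>unitary_group n\<^esub> y = y \<otimes>\<^bsub>unitary_group n\<^esub> x"
    "y \<otimes>\<^bsub>unitary_group n\<^esub> z = x \<otimes>\<^bsub>unitary_group n\<^esub> z \<otimes>\<^bsub>unitary_group n\<^esub> y"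
    using unitary_commutator_rigid[OF xy carr[OF z]] that unfolding unitary_group_simps by simp
qed

subsection \<open>Common eigenvectors\<close>

text \<open>This is the vector \<open>p(M) v\<close>, computed by Horner's scheme so that no matrix
  powers occur.\<close>

definition poly_act :: "'a::comm_ring_1 mat \<Rightarrow> 'a vec \<Rightarrow> 'a poly \<Rightarrow> 'a vec" where
  "poly_act M v p = fold_coeffs (\<lambda>a w. a \<cdot>\<^sub>v v + M *\<^sub>v w) p (0\<^sub>v (dim_vec v))"

context
  fixes M :: "'a::field mat" and v :: "'a vec" and n :: nat
  assumes M: "M \<in> carrier_mat n n" and v: "v \<in> carrier_vec n"
begin

lemma poly_act_0: "poly_act M v 0 = 0\<^sub>v n"
  using v by (simp add: poly_act_def)

lemma poly_act_pCons: "poly_act M v (pCons a p) = a \<cdot>\<^sub>v v + M *\<^sub>v poly_act M v p"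
\<comment> \<open>Since \<open>pCons 0 0\<close> is \<open>0\<close>, the fold does not process this
  coefficient, and the recursion is checked directly.\<close>
proof (cases "a = 0 \<and> p = 0")
  case True
  moreover have "0 \<cdot>\<^sub>v v + M *\<^sub>v 0\<^sub>v n = 0\<^sub>v n" using M v by (intro eq_vecI) auto
  ultimately show ?thesis using poly_act_0 by simp
next
  case False
  then show ?thesis
    unfolding poly_act_def by (cases "a = 0") simp_all
qed

lemma poly_act_carrier: "poly_act M v p \<in> carrier_vec n"
  using M v by (induction p) (auto simp: poly_act_0 poly_act_pCons)

lemma poly_act_add: "poly_act M v (p + q) = poly_act M v p + poly_act M v q"
proof (induction p q rule: poly_induct2)
  case (pCons a p b q)
  have "poly_act M v (pCons a p + pCons b q) = (a + b) \<cdot>\<^sub>v v + (M *\<^sub>v poly_act M v p + M *\<^sub>v poly_act M v q)"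
    using M v poly_act_carrier pCons by (simp add: poly_act_pCons mult_add_distrib_mat_vec)
  also have "\<dots> = (a \<cdot>\<^sub>v v + M *\<^sub>v poly_act M v p) + (b \<cdot>\<^sub>v v + M *\<^sub>v poly_act M v q)"
    using M v poly_act_carrier by (intro eq_vecI) (auto simp: algebra_simps)
  finally show ?case by (simp add: poly_act_pCons)
qed (simp add: poly_act_0)

lemma poly_act_smult: "poly_act M v (smult c p) = c \<cdot>\<^sub>v poly_act M v p"
proof (induction p)
  case (pCons a p)
  have "poly_act M v (smult c (pCons a p)) = (c * a) \<cdot>\<^sub>v v + c \<cdot>\<^sub>v (M *\<^sub>v poly_act M v p)"
    using pCons M poly_act_carrier by (simp add: poly_act_pCons mult_mat_vec)
  also have "\<dots> = c \<cdot>\<^sub>v (a \<cdot>\<^sub>v v + M *\<^sub>v poly_act M v p)"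
    using M v poly_act_carrier by (intro eq_vecI) (auto simp: algebra_simps)
  finally show ?case by (simp add: poly_act_pCons)
next
  case 0
  show ?case unfolding smult_0_right poly_act_0 by (intro eq_vecI) auto
qed

lemma poly_act_linear_factor:
  "poly_act M v ([:- l, 1:] * q) = M *\<^sub>v poly_act M v q - l \<cdot>\<^sub>v poly_act M v q"
proof -
  have "[:- l, 1:] * q = pCons 0 q + smult (- l) q" by simp
  then have "poly_act M v ([:- l, 1:] * q) = (0 \<cdot>\<^sub>v v + M *\<^sub>v poly_act M v q) + (- l) \<cdot>\<^sub>v poly_act M v q"
    by (simp only: poly_act_add poly_act_smult poly_act_pCons)
  also have "\<dots> = M *\<^sub>v poly_act M v q - l \<cdot>\<^sub>v poly_act M v q"
    using M carrier_vecD[OF v] carrier_vecD[OF poly_act_carrier] by (intro eq_vecI) auto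
  finally show ?thesis .
qed

text \<open>The length \<open>m\<close> of the sum may exceed the number of coefficients of
  \<open>p\<close>, so a coefficient vector of fixed size can be used whatever the degree
  is.\<close>

lemma poly_act_index:
  assumes "i < n" "\<And>j. m \<le> j \<Longrightarrow> coeff p j = 0"
  shows "poly_act M v p $ i = (\<Sum>j<m. coeff p j * ((\<lambda>w. M *\<^sub>v w) ^^ j) v $ i)"
  using assms
proof (induction p arbitrary: m i)
  case 0
  then show ?case by (simp add: poly_act_0)
next
  case (pCons a p)
  show ?case
  proof (cases m)
    case 0
    then have "pCons a p = 0" using pCons.prems(2) by (intro poly_eqI) simp
    then show ?thesis using pCons.hyps by auto
  next
    case (Suc m')
    let ?K = "\<lambda>j. ((\<lambda>w. M *\<^sub>v w) ^^ j) v"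
    have K: "?K j \<in> carrier_vec n" for j using M v by (induction j) auto
    have p: "coeff p j = 0" if "m' \<le> j" for j using pCons.prems(2)[of "Suc j"] that Suc by simp
    have "(M *\<^sub>v poly_act M v p) $ i = (\<Sum>k<n. M $$ (i, k) * poly_act M v p $ k)"
      using M pCons.prems(1) poly_act_carrier[of p] by (simp add: scalar_prod_def atLeast0LessThan)
    also have "\<dots> = (\<Sum>k<n. \<Sum>j<m'. coeff p j * (M $$ (i, k) * ?K j $ k))"
      using pCons.IH[OF _ p] by (intro sum.cong) (auto simp: sum_distrib_left mult_ac)
    also have "\<dots> = (\<Sum>j<m'. coeff p j * (\<Sum>k<n. M $$ (i, k) * ?K j $ k))"
      by (subst sum.swap) (simp add: sum_distrib_left)
    also have "\<dots> = (\<Sum>j<m'. coeff p j * ?K (Suc j) $ i)"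
      using M pCons.prems(1) carrier_vecD[OF K]
      by (intro sum.cong) (auto simp: scalar_prod_def atLeast0LessThan)
    finally show ?thesis
      using v M pCons.prems(1) poly_act_carrier unfolding Suc
      by (simp add: poly_act_pCons sum.lessThan_Suc_shift del: funpow.simps(2) sum.lessThan_Suc)
  qed
qed

text \<open>The \<open>n + 1\<close> vectors obtained by iterating \<open>M\<close> on
  \<open>v\<close> are linearly dependent; the coefficients of a dependence form
  \<open>p\<close>.\<close>

lemma exists_poly_act_0:
  obtains p where "p \<noteq> 0" "poly_act M v p = 0\<^sub>v n"
proof -
  let ?K = "\<lambda>j. ((\<lambda>w. M *\<^sub>v w) ^^ j) v"
  \<comment> \<open>The iterates are the columns, and a zero row at index \<open>n\<close> makes the
    matrix square and singular. A kernel vector is the dependence.\<close>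
  define A where "A = mat\<^sub>r (Suc n) (Suc n)
    (\<lambda>i. if i = n then 0\<^sub>v (Suc n) else vec (Suc n) (\<lambda>j. ?K j $ i))"
  have A: "A \<in> carrier_mat (Suc n) (Suc n)" by (simp add: A_def)
  have "det A = 0" unfolding A_def by (rule det_row_0) auto
  then obtain c where c: "c \<in> carrier_vec (Suc n)" "c \<noteq> 0\<^sub>v (Suc n)" "A *\<^sub>v c = 0\<^sub>v (Suc n)"
    using det_0_iff_vec_prod_zero_field[OF A] by blast
  define p where "p = Poly (map (\<lambda>j. c $ j) [0..<Suc n])"
  have p: "coeff p j = (if j < Suc n then c $ j else 0)" for j
    unfolding p_def by (simp add: nth_default_def del: upt_Suc)
  have "p \<noteq> 0"
  proof
    assume "p = 0"
    then have "c $ j = 0" if "j < Suc n" for j using p[of j] that by simp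
    then have "c = 0\<^sub>v (Suc n)" using c(1) by (intro eq_vecI) auto
    with c(2) show False ..
  qed
  moreover have "poly_act M v p = 0\<^sub>v n"
  proof (rule eq_vecI)
    fix i assume "i < dim_vec (0\<^sub>v n :: 'a vec)"
    then have i: "i < n" by simp
    have "row A i = vec (Suc n) (\<lambda>j. ?K j $ i)"
      unfolding A_def using i by (subst row_mat_of_row_fun) auto
    then have "(A *\<^sub>v c) $ i = (\<Sum>j<Suc n. ?K j $ i * c $ j)"
      using A i c(1) by (simp add: scalar_prod_def atLeast0LessThan del: sum.lessThan_Suc)
    moreover have "(A *\<^sub>v c) $ i = 0" using c(3) i by simp
    moreover have "poly_act M v p $ i = (\<Sum>j<Suc n. coeff p j * ?K j $ i)"
      using i p by (intro poly_act_index) auto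
    moreover have "(\<Sum>j<Suc n. coeff p j * ?K j $ i) = (\<Sum>j<Suc n. ?K j $ i * c $ j)"
      by (intro sum.cong) (simp_all add: p mult.commute)
    ultimately show "poly_act M v p $ i = 0\<^sub>v n $ i" using i by simp
  qed (use poly_act_carrier in auto)
  ultimately show thesis using that by blast
qed

end

text \<open>Split a linear factor off an annihilating polynomial. Either the cofactor
  \<open>q\<close> still annihilates \<open>v\<close>, with lower degree, or
  \<open>poly_act M v q\<close> is an eigenvector. An eigenvector of this form lies in every
  \<open>M\<close>-invariant subspace containing \<open>v\<close>.\<close>

lemma exists_eigenvector_poly_act:
  fixes M :: "complex mat"
  assumes M: "M \<in> carrier_mat n n" and v: "v \<in> carrier_vec n" "v \<noteq> 0\<^sub>v n"
  shows "\<exists>q l. poly_act M v q \<noteq> 0\<^sub>v n \<and> M *\<^sub>v poly_act M v q = l \<cdot>\<^sub>v poly_act M v q"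
proof -
  obtain p where p: "p \<noteq> 0" "poly_act M v p = 0\<^sub>v n" using exists_poly_act_0[OF M v(1)] .
  then show ?thesis
  proof (induction "degree p" arbitrary: p rule: less_induct)
    case less
    show ?case
    proof (cases "degree p = 0")
      case True
      then obtain a where a: "p = [:a:]" by (rule degree_eq_zeroE)
      \<comment> \<open>A nonzero constant cannot annihilate the nonzero \<open>v\<close>.\<close>
      have "poly_act M v p = a \<cdot>\<^sub>v v"
        unfolding a poly_act_pCons[OF M v(1)] poly_act_0[OF M v(1)] using M v by (intro eq_vecI) auto
      then have "v = (1 / a) \<cdot>\<^sub>v 0\<^sub>v n"
        using less.prems a by (metis one_smult_vec smult_smult_assoc nonzero_divide_eq_eq pCons_0_0)
      also have "(1 / a) \<cdot>\<^sub>v 0\<^sub>v n = 0\<^sub>v n" by (intro eq_vecI) auto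
      finally show ?thesis using v(2) by simp
    next
      case False
      then obtain l where "poly p l = 0"
        using fundamental_theorem_of_algebra by (metis constant_degree)
      then obtain q where q: "p = [:- l, 1:] * q" using poly_eq_0_iff_dvd by blast
      show ?thesis
      proof (cases "poly_act M v q = 0\<^sub>v n")
        case True
        have q0: "q \<noteq> 0" using q less.prems(1) by auto
        then have "degree q < degree p" unfolding q by (subst degree_mult_eq) auto
        then show ?thesis using less.hyps q0 True by blast
      next
        case False
        let ?u = "poly_act M v q"
        have u: "?u \<in> carrier_vec n" by (rule poly_act_carrier[OF M v(1)])
        have *: "M *\<^sub>v ?u - l \<cdot>\<^sub>v ?u = 0\<^sub>v n"
          using less.prems(2) poly_act_linear_factor[OF M v(1)] q by simp
        have "M *\<^sub>v ?u = l \<cdot>\<^sub>v ?u"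
        proof (rule eq_vecI)
          fix i assume "i < dim_vec (l \<cdot>\<^sub>v ?u)"
          then show "(M *\<^sub>v ?u) $ i = (l \<cdot>\<^sub>v ?u) $ i"
            using arg_cong[OF *, of "\<lambda>x. x $ i"] M u by simp
        qed (use M u in auto)
        then show ?thesis using False by blast
      qed
    qed
  qed
qed

text \<open>Given a common eigenvector \<open>u\<close> of the earlier matrices, take an eigenvector
  \<open>poly_act M u q\<close> of \<open>M\<close>. It stays in the invariant subspace
  \<open>W\<close>, and each earlier matrix, commuting with \<open>M\<close>, acts on it by the same
  scalar as on \<open>u\<close>.\<close>

lemma common_eigenvector:
  fixes S :: "complex mat set"
  assumes "finite S" and S: "S \<subseteq> carrier_mat n n"
    and comm: "\<And>A B. A \<in> S \<Longrightarrow> B \<in> S \<Longrightarrow> A * B = B * A"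
    and W: "W \<subseteq> carrier_vec n" "0\<^sub>v n \<in> W" "\<And>x y. x \<in> W \<Longrightarrow> y \<in> W \<Longrightarrow> x + y \<in> W"
      "\<And>c x. x \<in> W \<Longrightarrow> c \<cdot>\<^sub>v x \<in> W" "\<And>A x. A \<in> S \<Longrightarrow> x \<in> W \<Longrightarrow> A *\<^sub>v x \<in> W"
    and w: "w \<in> W" "w \<noteq> 0\<^sub>v n"
  shows "\<exists>u\<in>W. u \<noteq> 0\<^sub>v n \<and> (\<forall>A\<in>S. \<exists>l. A *\<^sub>v u = l \<cdot>\<^sub>v u)"
  using assms(1) S comm W(5)
proof (induction S)
  case empty
  then show ?case using w by blast
next
  case (insert M S)
  then obtain u where u: "u \<in> W" "u \<noteq> 0\<^sub>v n" "\<forall>A\<in>S. \<exists>l. A *\<^sub>v u = l \<cdot>\<^sub>v u" by auto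
  have M: "M \<in> carrier_mat n n" and uc: "u \<in> carrier_vec n" using insert.prems(1) u W(1) by auto
  obtain q l where q: "poly_act M u q \<noteq> 0\<^sub>v n" "M *\<^sub>v poly_act M u q = l \<cdot>\<^sub>v poly_act M u q"
    using exists_eigenvector_poly_act[OF M uc u(2)] by blast
  have "poly_act M u p \<in> W" for p
    using u(1) W insert.prems(3) by (induction p) (auto simp: poly_act_0[OF M uc] poly_act_pCons[OF M uc])
  moreover have "\<exists>l. A *\<^sub>v poly_act M u q = l \<cdot>\<^sub>v poly_act M u q" if A: "A \<in> S" for A
  proof -
    obtain l where l: "A *\<^sub>v u = l \<cdot>\<^sub>v u" using u(3) A by blast
    have Ac: "A \<in> carrier_mat n n" using A insert.prems(1) by auto
    have AM: "A * M = M * A" using A insert.prems(2) by blast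
    have "A *\<^sub>v poly_act M u p = l \<cdot>\<^sub>v poly_act M u p" for p
    proof (induction p)
      case 0
      show ?case unfolding poly_act_0[OF M uc] using Ac by (intro eq_vecI) auto
    next
      case (pCons a p)
      let ?p = "poly_act M u p"
      have pc: "?p \<in> carrier_vec n" by (rule poly_act_carrier[OF M uc])
      have "A *\<^sub>v (M *\<^sub>v ?p) = M *\<^sub>v (A *\<^sub>v ?p)"
        using assoc_mult_mat_vec[OF Ac M pc] assoc_mult_mat_vec[OF M Ac pc] AM by simp
      also have "\<dots> = l \<cdot>\<^sub>v (M *\<^sub>v ?p)" using pCons M pc by (simp add: mult_mat_vec)
      finally have "A *\<^sub>v (a \<cdot>\<^sub>v u + M *\<^sub>v ?p) = a \<cdot>\<^sub>v (l \<cdot>\<^sub>v u) + l \<cdot>\<^sub>v (M *\<^sub>v ?p)"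
        using Ac M uc pc l by (simp add: mult_add_distrib_mat_vec mult_mat_vec)
      also have "\<dots> = l \<cdot>\<^sub>v (a \<cdot>\<^sub>v u + M *\<^sub>v ?p)"
        using M uc pc by (intro eq_vecI) (auto simp: algebra_simps)
      finally show ?case unfolding poly_act_pCons[OF M uc] .
    qed
    then show ?thesis by blast
  qed
  ultimately show ?case using q by blast
qed

section \<open>The Hermitian form and orthonormal eigenbases\<close>

definition herm :: "nat \<Rightarrow> complex vec \<Rightarrow> complex vec \<Rightarrow> complex" where
  "herm n v w = (\<Sum>i<n. v $ i * cnj (w $ i))"

lemma herm_commute: "herm n v w = cnj (herm n w v)"
  by (simp add: herm_def mult.commute)

lemma herm_smult:
  "v \<in> carrier_vec n \<Longrightarrow> herm n (c \<cdot>\<^sub>v v) w = c * herm n v w"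
  "w \<in> carrier_vec n \<Longrightarrow> herm n v (c \<cdot>\<^sub>v w) = cnj c * herm n v w"
  by (simp_all add: herm_def sum_distrib_left mult_ac)

lemma herm_add:
  "v \<in> carrier_vec n \<Longrightarrow> v' \<in> carrier_vec n \<Longrightarrow> herm n (v + v') w = herm n v w + herm n v' w"
  by (simp add: herm_def distrib_right sum.distrib)

lemma herm_self: "herm n v v = of_real (\<Sum>i<n. cmod (v $ i) ^ 2)"
  by (simp add: herm_def complex_norm_square del: of_real_power)

lemma herm_unitary:
  assumes U: "U \<in> carrier (unitary_group n)" and v: "v \<in> carrier_vec n" and w: "w \<in> carrier_vec n"
  shows "herm n (U *\<^sub>v v) (U *\<^sub>v w) = herm n v w"
proof -
  have Uc: "U \<in> carrier_mat n n" "mat_adjoint U * U = 1\<^sub>m n" using U by (auto simp: unitary_group_def)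
  have UU: "(\<Sum>i<n. U $$ (i, k) * cnj (U $$ (i, l))) = (if k = l then 1 else 0)" if "k < n" "l < n" for k l
  proof -
    have "(mat_adjoint U * U) $$ (l, k) = (\<Sum>i<n. cnj (U $$ (i, l)) * U $$ (i, k))"
      using that Uc(1) mat_adjoint_carrier[OF Uc(1)]
      by (simp add: scalar_prod_def atLeast0LessThan mat_adjoint_index[OF Uc(1)])
    then show ?thesis using Uc(2) that by (auto simp: mult.commute)
  qed
  have "herm n (U *\<^sub>v v) (U *\<^sub>v w) =
      (\<Sum>i<n. (\<Sum>k<n. U $$ (i, k) * v $ k) * (\<Sum>l<n. cnj (U $$ (i, l)) * cnj (w $ l)))"
    using Uc v w by (simp add: herm_def scalar_prod_def atLeast0LessThan)
  also have "\<dots> = (\<Sum>i<n. \<Sum>k<n. \<Sum>l<n. v $ k * cnj (w $ l) * (U $$ (i, k) * cnj (U $$ (i, l))))"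
    by (simp add: sum_product mult_ac)
  also have "\<dots> = (\<Sum>k<n. \<Sum>i<n. \<Sum>l<n. v $ k * cnj (w $ l) * (U $$ (i, k) * cnj (U $$ (i, l))))"
    by (rule sum.swap)
  also have "\<dots> = (\<Sum>k<n. \<Sum>l<n. \<Sum>i<n. v $ k * cnj (w $ l) * (U $$ (i, k) * cnj (U $$ (i, l))))"
    by (intro sum.cong refl sum.swap)
  also have "\<dots> = (\<Sum>k<n. \<Sum>l<n. v $ k * cnj (w $ l) * (if k = l then 1 else 0))"
    unfolding sum_distrib_left[symmetric] using UU by (intro sum.cong) auto
  also have "\<dots> = herm n v w" by (simp add: herm_def if_distrib cong: if_cong)
  finally show ?thesis .
qed

text \<open>Fewer than \<open>n\<close> linear equations in \<open>n\<close> unknowns have a nonzero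
  solution.\<close>

lemma exists_orthogonal_vector:
  assumes "length vs < n"
  shows "\<exists>w \<in> carrier_vec n. w \<noteq> 0\<^sub>v n \<and> (\<forall>v\<in>set vs. herm n w v = 0)"
proof -
  define k where "k = length vs"
  have k: "k < n" using assms by (simp add: k_def)
  define f where "f i = (if i < k then vec n (\<lambda>j. cnj (vs ! i $ j)) else 0\<^sub>v n)" for i
  \<comment> \<open>Zero rows pad the conjugated vectors to a square matrix; row \<open>k\<close> is
    singled out to match the form of \<open>det_row_0\<close>.\<close>
  define A where "A = mat\<^sub>r n n (\<lambda>i. if i = k then 0\<^sub>v n else f i)"
  have A: "A \<in> carrier_mat n n" by (simp add: A_def)
  have "det A = 0" unfolding A_def using k by (intro det_row_0) (auto simp: f_def)
  then obtain c where c: "c \<in> carrier_vec n" "c \<noteq> 0\<^sub>v n" "A *\<^sub>v c = 0\<^sub>v n"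
    using det_0_iff_vec_prod_zero_field[OF A] by blast
  have "herm n c (vs ! i) = 0" if i: "i < k" for i
  proof -
    have "row A i = f i" unfolding A_def using i k by (subst row_mat_of_row_fun) (auto simp: f_def)
    then have "(A *\<^sub>v c) $ i = (\<Sum>j<n. cnj (vs ! i $ j) * c $ j)"
      using A i k c(1) by (simp add: scalar_prod_def atLeast0LessThan f_def)
    then show ?thesis using c(3) i k by (simp add: herm_def mult.commute)
  qed
  then show ?thesis using c(1,2) unfolding k_def by (intro bexI[of _ c]) (auto simp: in_set_conv_nth)
qed

text \<open>The orthogonal complement of common eigenvectors is invariant under the unitary matrices
  in \<open>S\<close>, so the next vector is a normalised common eigenvector inside it.\<close>

lemma exists_orthonormal_eigenvectors:
  assumes S: "finite S" "S \<subseteq> carrier (unitary_group n)"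
    and comm: "\<And>A B. A \<in> S \<Longrightarrow> B \<in> S \<Longrightarrow> A * B = B * A"
  shows "k \<le> n \<Longrightarrow> \<exists>vs. length vs = k \<and> set vs \<subseteq> carrier_vec n \<and>
    (\<forall>i<k. \<forall>j<k. herm n (vs ! i) (vs ! j) = (if i = j then 1 else 0)) \<and>
    (\<forall>A\<in>S. \<forall>v\<in>set vs. \<exists>l. A *\<^sub>v v = l \<cdot>\<^sub>v v)"
proof (induction k)
  case 0
  show ?case by simp
next
  case (Suc k)
  then obtain vs where vs: "length vs = k" "set vs \<subseteq> carrier_vec n"
    "\<And>i j. i < k \<Longrightarrow> j < k \<Longrightarrow> herm n (vs ! i) (vs ! j) = (if i = j then 1 else 0)"
    "\<And>A v. A \<in> S \<Longrightarrow> v \<in> set vs \<Longrightarrow> \<exists>l. A *\<^sub>v v = l \<cdot>\<^sub>v v" by auto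
  have Sc: "S \<subseteq> carrier_mat n n" using S(2) unitary_carrier_mat by blast
  define W where "W = {w \<in> carrier_vec n. \<forall>v\<in>set vs. herm n w v = 0}"
  obtain w where w: "w \<in> W" "w \<noteq> 0\<^sub>v n"
    using exists_orthogonal_vector[of vs n] vs(1) Suc.prems unfolding W_def by auto
  have inv: "A *\<^sub>v x \<in> W" if A: "A \<in> S" and x: "x \<in> W" for A x
  proof -
    have Ac: "A \<in> carrier_mat n n" "A \<in> carrier (unitary_group n)" using A S Sc by auto
    have xc: "x \<in> carrier_vec n" using x by (simp add: W_def)
    have "herm n (A *\<^sub>v x) v = 0" if v: "v \<in> set vs" for v
    proof -
      have vc: "v \<in> carrier_vec n" using v vs(2) by auto
      obtain l where l: "A *\<^sub>v v = l \<cdot>\<^sub>v v" using vs(4) A v by blast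
      obtain i where i: "i < k" "v = vs ! i" using v vs(1) by (auto simp: in_set_conv_nth)
      \<comment> \<open>Preservation of the form makes the eigenvalue \<open>l\<close> nonzero, so
        it can be cancelled below.\<close>
      have "1 = herm n (A *\<^sub>v v) (A *\<^sub>v v)" using herm_unitary[OF Ac(2) vc vc] vs(3)[OF i(1) i(1)] i by simp
      then have "l \<noteq> 0" unfolding l using herm_smult(1)[OF vc] by auto
      have "cnj l * herm n (A *\<^sub>v x) v = herm n (A *\<^sub>v x) (A *\<^sub>v v)"
        unfolding l herm_smult(2)[OF vc] ..
      also have "\<dots> = 0" using herm_unitary[OF Ac(2) xc vc] x v by (simp add: W_def)
      finally show ?thesis using \<open>l \<noteq> 0\<close> by simp
    qed
    then show ?thesis using Ac xc by (simp add: W_def)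
  qed
  have "0\<^sub>v n \<in> W" by (simp add: W_def herm_def)
  then have "\<exists>u\<in>W. u \<noteq> 0\<^sub>v n \<and> (\<forall>A\<in>S. \<exists>l. A *\<^sub>v u = l \<cdot>\<^sub>v u)"
    using S(1) Sc comm inv w
    by (intro common_eigenvector) (auto simp: W_def herm_add herm_smult)
  then obtain u where u: "u \<in> W" "u \<noteq> 0\<^sub>v n" "\<And>A. A \<in> S \<Longrightarrow> \<exists>l. A *\<^sub>v u = l \<cdot>\<^sub>v u" by blast
  have uc: "u \<in> carrier_vec n" using u(1) by (simp add: W_def)
  define s where "s = (\<Sum>i<n. cmod (u $ i) ^ 2)"
  have "\<exists>i<n. u $ i \<noteq> 0"
  proof (rule ccontr)
    assume "\<not> (\<exists>i<n. u $ i \<noteq> 0)"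
    then have "u = 0\<^sub>v n" using uc by (intro eq_vecI) auto
    with u(2) show False ..
  qed
  then obtain i where i: "i < n" "u $ i \<noteq> 0" by blast
  then have "0 < cmod (u $ i) ^ 2" by simp
  also have "\<dots> \<le> s" unfolding s_def using i by (intro member_le_sum) auto
  finally have s: "0 < s" .
  define u' where "u' = complex_of_real (1 / sqrt s) \<cdot>\<^sub>v u"
  have u'c: "u' \<in> carrier_vec n" using uc by (simp add: u'_def)
  have "herm n u' u' = of_real (1 / sqrt s) * of_real (1 / sqrt s) * of_real s"
    unfolding u'_def using uc herm_self[of n u] by (simp add: herm_smult s_def)
  also have "\<dots> = of_real (1 / sqrt s * (1 / sqrt s) * s)" by (simp only: of_real_mult)
  also have "1 / sqrt s * (1 / sqrt s) * s = 1" using s by (simp add: field_simps)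
  finally have u'1: "herm n u' u' = 1" by simp
  have u'0: "herm n u' (vs ! i) = 0" "herm n (vs ! i) u' = 0" if "i < k" for i
  proof -
    show "herm n u' (vs ! i) = 0"
      unfolding u'_def using u(1) uc that vs(1) by (simp add: herm_smult W_def)
    then show "herm n (vs ! i) u' = 0" by (subst herm_commute) simp
  qed
  have "\<exists>l. A *\<^sub>v u' = l \<cdot>\<^sub>v u'" if A: "A \<in> S" for A
  proof -
    obtain l where l: "A *\<^sub>v u = l \<cdot>\<^sub>v u" using u(3) A by blast
    have "A *\<^sub>v u' = l \<cdot>\<^sub>v u'"
      unfolding u'_def using mult_mat_vec[OF subsetD[OF Sc A] uc] l by (simp add: smult_smult_assoc mult.commute)
    then show ?thesis by blast
  qed
  then have "\<forall>A\<in>S. \<forall>v\<in>set (vs @ [u']). \<exists>l. A *\<^sub>v v = l \<cdot>\<^sub>v v" using vs(4) by auto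
  moreover have "herm n ((vs @ [u']) ! i) ((vs @ [u']) ! j) = (if i = j then 1 else 0)"
    if "i < Suc k" "j < Suc k" for i j
    using that u'1 u'0 vs(1,3) by (auto simp: nth_append less_Suc_eq)
  ultimately show ?case using vs(1,2) u'c by (intro exI[of _ "vs @ [u']"]) auto
qed

text \<open>The columns of \<open>P\<close> are the eigenbasis. Entry \<open>(i, j)\<close> of the
  conjugated matrix is an eigenvalue times \<open>herm n (vs ! j) (vs ! i)\<close>, which vanishes
  off the diagonal.\<close>

lemma exists_unitary_diagonalizing:
  assumes S: "finite S" "S \<subseteq> carrier (unitary_group n)"
    and comm: "\<And>A B. A \<in> S \<Longrightarrow> B \<in> S \<Longrightarrow> A * B = B * A"
  obtains P where "P \<in> carrier (unitary_group n)" "\<And>A. A \<in> S \<Longrightarrow> diagonal_mat (mat_adjoint P * A * P)"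
proof -
  obtain vs where vs: "length vs = n" "set vs \<subseteq> carrier_vec n"
    "\<And>i j. i < n \<Longrightarrow> j < n \<Longrightarrow> herm n (vs ! i) (vs ! j) = (if i = j then 1 else 0)"
    "\<And>A v. A \<in> S \<Longrightarrow> v \<in> set vs \<Longrightarrow> \<exists>l. A *\<^sub>v v = l \<cdot>\<^sub>v v"
    using exists_orthonormal_eigenvectors[OF S comm order_refl] by blast
  define P where "P = mat n n (\<lambda>(i, j). vs ! j $ i)"
  have P: "P \<in> carrier_mat n n" and Pij: "\<And>i j. i < n \<Longrightarrow> j < n \<Longrightarrow> P $$ (i, j) = vs ! j $ i"
    by (simp_all add: P_def)
  note P' = mat_adjoint_carrier[OF P]
  have PX: "(mat_adjoint P * X) $$ (i, j) = (\<Sum>k<n. X $$ (k, j) * cnj (vs ! i $ k))"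
    if "X \<in> carrier_mat n n" "i < n" "j < n" for X i j
    using that P P'
    by (auto simp: scalar_prod_def atLeast0LessThan mat_adjoint_index[OF P] Pij mult.commute intro!: sum.cong)
  have PP: "mat_adjoint P * P = 1\<^sub>m n"
  proof (rule eq_matI)
    fix i j assume "i < dim_row (1\<^sub>m n :: complex mat)" "j < dim_col (1\<^sub>m n :: complex mat)"
    then have ij: "i < n" "j < n" by auto
    then have "(mat_adjoint P * P) $$ (i, j) = herm n (vs ! j) (vs ! i)"
      unfolding PX[OF P ij] herm_def by (simp add: P_def)
    then show "(mat_adjoint P * P) $$ (i, j) = 1\<^sub>m n $$ (i, j)" using vs(3) ij by simp
  qed (use P P' in auto)
  then have "P * mat_adjoint P = 1\<^sub>m n" using mat_mult_left_right_inverse[OF P' P] by simp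
  then have PU: "P \<in> carrier (unitary_group n)" using P PP by (simp add: unitary_group_def)
  have "diagonal_mat (mat_adjoint P * A * P)" if A: "A \<in> S" for A
  proof -
    have Ac: "A \<in> carrier_mat n n" using A S(2) unitary_carrier_mat by blast
    have "(mat_adjoint P * A * P) $$ (i, j) = 0" if ij: "i < n" "j < n" "i \<noteq> j" for i j
    proof -
      have vj: "vs ! j \<in> set vs" "vs ! j \<in> carrier_vec n" using vs(1,2) ij by auto
      then obtain l where l: "A *\<^sub>v (vs ! j) = l \<cdot>\<^sub>v (vs ! j)" using vs(4) A by blast
      have colP: "col P j = vs ! j" using vj ij by (intro eq_vecI) (auto simp: P_def)
      have AP: "(A * P) $$ (k, j) = l * vs ! j $ k" if "k < n" for k
        using arg_cong[OF l, of "\<lambda>v. v $ k"] that ij Ac P vj colP by simp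
      have "mat_adjoint P * A * P = mat_adjoint P * (A * P)" using P P' Ac by simp
      then have "(mat_adjoint P * A * P) $$ (i, j) = (\<Sum>k<n. (A * P) $$ (k, j) * cnj (vs ! i $ k))"
        using PX[of "A * P" i j] Ac P ij by simp
      also have "\<dots> = l * herm n (vs ! j) (vs ! i)"
        unfolding herm_def sum_distrib_left using AP by (intro sum.cong) auto
      finally show ?thesis using vs(3)[of j i] ij by simp
    qed
    then show ?thesis using P P' Ac by (auto simp: diagonal_mat_def)
  qed
  then show thesis using that PU by blast
qed

lemma simultaneously_diagonalisable_commuting_unitary:
  assumes S: "finite S" "S \<subseteq> carrier (unitary_group n)"
    and comm: "\<And>A B. A \<in> S \<Longrightarrow> B \<in> S \<Longrightarrow> A * B = B * A"
  shows "simultaneously_diagonalisable S"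
proof -
  obtain P where P: "P \<in> carrier (unitary_group n)"
    and D: "\<And>A. A \<in> S \<Longrightarrow> diagonal_mat (mat_adjoint P * A * P)"
    using exists_unitary_diagonalizing[OF S comm] by blast
  have Pc: "P \<in> carrier_mat n n" "mat_adjoint P \<in> carrier_mat n n"
    "P * mat_adjoint P = 1\<^sub>m n" "mat_adjoint P * P = 1\<^sub>m n"
    using P mat_adjoint_carrier by (auto simp: unitary_group_def)
  have "similar_mat_wit A (mat_adjoint P * A * P) P (mat_adjoint P)" if A: "A \<in> S" for A
  proof -
    have Ac: "A \<in> carrier_mat n n" using A S(2) unitary_carrier_mat by blast
    have "P * (mat_adjoint P * A * P) * mat_adjoint P = (P * mat_adjoint P) * A * (P * mat_adjoint P)"
      using Pc(1,2) Ac by (simp add: assoc_mult_mat[of _ n n _ n _ n])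
    then have "P * (mat_adjoint P * A * P) * mat_adjoint P = A" using Pc Ac by simp
    then show ?thesis using Pc Ac by (auto simp: similar_mat_wit_def Let_def)
  qed
  then show ?thesis unfolding simultaneously_diagonalisable_def using D by blast
qed

section \<open>The length of commuting chains in the unitary group\<close>

lemma diagonal_mult_index:
  assumes "X \<in> carrier_mat n n" "Y \<in> carrier_mat n n" "diagonal_mat Y" "i < n" "j < n"
  shows "(X * Y) $$ (i, j) = X $$ (i, j) * Y $$ (j, j)" "(Y * X) $$ (i, j) = Y $$ (i, i) * (X $$ (i, j) :: 'a::comm_ring_1)"
proof -
  have "(X * Y) $$ (i, j) = (\<Sum>k<n. X $$ (i, k) * Y $$ (k, j))"
    using assms by (simp add: scalar_prod_def atLeast0LessThan)
  also have "\<dots> = (\<Sum>k<n. if k = j then X $$ (i, j) * Y $$ (j, j) else 0)"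
    using assms by (intro sum.cong) (auto simp: diagonal_mat_def)
  finally show "(X * Y) $$ (i, j) = X $$ (i, j) * Y $$ (j, j)" using assms by simp
  have "(Y * X) $$ (i, j) = (\<Sum>k<n. Y $$ (i, k) * X $$ (k, j))"
    using assms by (simp add: scalar_prod_def atLeast0LessThan)
  also have "\<dots> = (\<Sum>k<n. if k = i then Y $$ (i, i) * X $$ (i, j) else 0)"
    using assms by (intro sum.cong) (auto simp: diagonal_mat_def)
  finally show "(Y * X) $$ (i, j) = Y $$ (i, i) * X $$ (i, j)" using assms by simp
qed

lemma commuting_chain_commute:
  assumes "commuting_chain G gs" "g \<in> set gs" "h \<in> set gs"
  shows "g \<otimes>\<^bsub>G\<^esub> h = h \<otimes>\<^bsub>G\<^esub> g"
  using assms by (induction gs) (auto simp: centralizer_def)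

text \<open>Group the basis vectors of a common eigenbasis by their eigenvalue tuples. A matrix commuting
  with the old members of the chain but not with the new one has a nonzero entry linking two
  basis vectors in the same group with distinct eigenvalues for the new member; so each new
  member splits some group.\<close>

lemma length_commuting_chain_unitary:
  assumes chain: "commuting_chain (unitary_group n) gs" and n: "1 \<le> n"
  shows "length gs < n"
proof -
  let ?U = "unitary_group n"
  have gsU: "set gs \<subseteq> carrier ?U" using commuting_chain_carrier[OF chain] .
  obtain P where P: "P \<in> carrier ?U" "\<And>g. g \<in> set gs \<Longrightarrow> diagonal_mat (mat_adjoint P * g * P)"
    using exists_unitary_diagonalizing[OF finite_set gsU] commuting_chain_commute[OF chain]
    unfolding unitary_group_simps by blast
  have Pc: "P \<in> carrier_mat n n" "mat_adjoint P \<in> carrier_mat n n" "P * mat_adjoint P = 1\<^sub>m n"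
    "mat_adjoint P * P = 1\<^sub>m n"
    using P(1) mat_adjoint_carrier by (auto simp: unitary_group_def)
  define D where "D g = mat_adjoint P * g * P" for g
  have Dc: "D g \<in> carrier_mat n n" if "g \<in> carrier_mat n n" for g using that Pc by (simp add: D_def)
  have Dmult: "D g * D h = D (g * h)" if "g \<in> carrier_mat n n" "h \<in> carrier_mat n n" for g h
  proof -
    have "D g * D h = mat_adjoint P * g * (P * mat_adjoint P) * h * P"
      unfolding D_def using that Pc(1,2) by (simp add: assoc_mult_mat[of _ n n _ n _ n])
    also have "\<dots> = D (g * h)"
      unfolding D_def Pc(3) using that Pc(1,2) by (simp add: assoc_mult_mat[of _ n n _ n _ n])
    finally show ?thesis .
  qed
  have Dinj: "g = h" if "D g = D h" "g \<in> carrier_mat n n" "h \<in> carrier_mat n n" for g h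
  proof -
    have PDP: "P * D x * mat_adjoint P = x" if "x \<in> carrier_mat n n" for x
    proof -
      have "P * D x * mat_adjoint P = (P * mat_adjoint P) * x * (P * mat_adjoint P)"
        unfolding D_def using that Pc(1,2) by (simp add: assoc_mult_mat[of _ n n _ n _ n])
      then show ?thesis using that Pc by simp
    qed
    show ?thesis using PDP[OF that(2)] PDP[OF that(3)] unfolding that(1) by (rule trans[OF sym])
  qed
  \<comment> \<open>\<open>F gs i\<close> lists the eigenvalues of the members of \<open>gs\<close>
    on column \<open>i\<close> of \<open>P\<close>; distinct tuples belong to distinct joint
    eigenspaces.\<close>
  define F where "F gs i = map (\<lambda>g. D g $$ (i, i)) gs" for gs and i :: nat
  have "length gs < card (F gs ` {..<n})"
    using chain P(2)
  proof (induction gs)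
    case Nil
    \<comment> \<open>Since \<open>1 \<le> n\<close>, the empty chain already has one tuple; this
      start makes the final inequality strict.\<close>
    have "F [] ` {..<n} = {[]}" using n by (simp add: F_def image_constant_conv lessThan_empty_iff)
    then show ?case by simp
  next
    case (Cons g gs)
    have IH: "length gs < card (F gs ` {..<n})" using Cons by simp
    have diag: "diagonal_mat (D x)" if "x \<in> set (g # gs)" for x using Cons.prems(2)[OF that] by (simp add: D_def)
    have carr: "x \<in> carrier_mat n n" if "x \<in> set (g # gs)" for x
      using commuting_chain_carrier[OF Cons.prems(1)] that unitary_carrier_mat by blast
    obtain h where h: "h \<in> centralizer ?U (set gs)" "h * g \<noteq> g * h"
      using Cons.prems(1) by (auto simp: unitary_group_simps)
    have hc: "h \<in> carrier_mat n n" using h(1) unitary_carrier_mat by (auto simp: centralizer_def)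
    have "D h * D g \<noteq> D g * D h" using Dmult Dinj h(2) hc carr[of g] by (metis list.set_intros(1) mult_carrier_mat)
    then have "\<exists>i<n. \<exists>j<n. (D h * D g) $$ (i, j) \<noteq> (D g * D h) $$ (i, j)"
      using Dc[OF hc] Dc[OF carr[of g]] by (auto simp: mat_eq_iff simp del: index_mult_mat(1))
    then obtain i j where ij: "i < n" "j < n" "(D h * D g) $$ (i, j) \<noteq> (D g * D h) $$ (i, j)"
      by blast
    \<comment> \<open>As \<open>D g\<close> is diagonal, both products have at \<open>(i, j)\<close>
      the entry of \<open>D h\<close> scaled by an eigenvalue of \<open>g\<close>.\<close>
    then have ij': "D h $$ (i, j) \<noteq> 0" "D g $$ (i, i) \<noteq> D g $$ (j, j)"
      using diagonal_mult_index[OF Dc[OF hc] Dc[OF carr[of g]] diag[of g] ij(1,2)] by auto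
    have "D x $$ (i, i) = D x $$ (j, j)" if x: "x \<in> set gs" for x
    proof -
      have x': "x \<in> set (g # gs)" using x by simp
      have "h * x = x * h" using h(1) x by (auto simp: centralizer_def unitary_group_simps)
      then have "D h * D x = D x * D h" using Dmult[OF hc carr[OF x']] Dmult[OF carr[OF x'] hc] by simp
      then show ?thesis
        using diagonal_mult_index[OF Dc[OF hc] Dc[OF carr[OF x']] diag[OF x'] ij(1,2)] ij'(1) by simp
    qed
    \<comment> \<open>Forgetting the newest eigenvalue identifies two different tuples, so adding
      \<open>g\<close> increases the number of tuples.\<close>
    then have "tl (F (g # gs) i) = tl (F (g # gs) j)" by (simp add: F_def)
    moreover have "F (g # gs) i \<noteq> F (g # gs) j" using ij'(2) by (simp add: F_def)
    ultimately have "\<not> inj_on tl (F (g # gs) ` {..<n})" using ij(1,2) by (auto simp: inj_on_def)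
    then have "card (tl ` F (g # gs) ` {..<n}) < card (F (g # gs) ` {..<n})"
      using card_image_le[of "F (g # gs) ` {..<n}" tl] eq_card_imp_inj_on[of "F (g # gs) ` {..<n}" tl]
      by (auto simp: order_less_le)
    moreover have "tl ` F (g # gs) ` {..<n} = F gs ` {..<n}" by (simp add: F_def image_image)
    ultimately show ?case using IH by simp
  qed
  also have "\<dots> \<le> n" using card_image_le[of "{..<n}" "F gs"] by simp
  finally show ?thesis .
qed

subsection \<open>Covering the unitary group by small cells\<close>

text \<open>With mesh \<open>1 / (8 * n)\<close>, each of the \<open>n ^ 2\<close> entries
  contributes at most \<open>2 / (64 * n ^ 2)\<close> to a squared distance within a cell; the total
  \<open>1 / 32\<close> is below \<open>1 / 25\<close>. The use of \<open>restrict\<close> puts the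
  cells into a \<open>PiE\<close> of known size.\<close>

definition unitary_cell :: "nat \<Rightarrow> complex mat \<Rightarrow> nat \<times> nat \<Rightarrow> int \<times> int" where
  "unitary_cell n U = restrict (\<lambda>(i, j). (\<lfloor>real (8 * n) * Re (U $$ (i, j))\<rfloor>, \<lfloor>real (8 * n) * Im (U $$ (i, j))\<rfloor>))
     ({..<n} \<times> {..<n})"

text \<open>A crude bound suffices: an entry is at most the Frobenius norm, which by unitary
  invariance is that of the identity.\<close>

lemma unitary_entry_le:
  assumes U: "U \<in> carrier (unitary_group n)" and ij: "i < n" "j < n"
  shows "cmod (U $$ (i, j)) \<le> real n"
proof -
  have Uc: "U \<in> carrier_mat n n" using U unitary_carrier_mat by blast
  have "cmod (U $$ (i, j)) \<le> frob_norm U"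
    unfolding frob_norm_carrier[OF Uc]
    using member_le_L2_set[of "{..<n} \<times> {..<n}" "(i, j)" "\<lambda>(i, j). cmod (U $$ (i, j))"] ij by simp
  also have "frob_norm U = frob_norm (1\<^sub>m n)"
    using frob_norm_unitary_left[OF U one_carrier_mat] Uc by simp
  also have "\<dots> \<le> real n"
  proof (rule power2_le_imp_le)
    have "frob_norm (1\<^sub>m n) ^ 2 = (\<Sum>i<n. \<Sum>j<n. if i = j then 1 else 0)"
      unfolding frob_norm_power2[OF one_carrier_mat] by (intro sum.cong) auto
    also have "\<dots> = real n" by simp
    also have "\<dots> \<le> real n ^ 2" using ij(1) by (simp add: power2_eq_square)
    finally show "frob_norm (1\<^sub>m n) ^ 2 \<le> real n ^ 2" .
  qed simp
  finally show ?thesis .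
qed

lemma floor_mult_mem:
  assumes "\<bar>x\<bar> \<le> real n"
  shows "\<lfloor>real (8 * n) * x\<rfloor> \<in> {- int (8 * n ^ 2)..int (8 * n ^ 2)}"
proof -
  have "\<bar>real (8 * n) * x\<bar> \<le> real (8 * n) * real n"
    unfolding abs_mult using assms by (intro mult_mono) auto
  then have "\<bar>real (8 * n) * x\<bar> \<le> real (8 * n ^ 2)" by (simp add: power2_eq_square mult.assoc)
  then have "real_of_int (- int (8 * n ^ 2)) \<le> real (8 * n) * x"
    "real (8 * n) * x < real_of_int (int (8 * n ^ 2)) + 1"
    unfolding of_int_minus of_int_of_nat_eq by linarith+
  then show ?thesis unfolding atLeastAtMost_iff le_floor_iff floor_le_iff by blast
qed

text \<open>There are \<open>2 * n ^ 2\<close> real coordinates, each with at most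
  \<open>16 * n ^ 2 + 1\<close> possible floors.\<close>

lemma card_unitary_cell:
  assumes A: "A \<subseteq> carrier (unitary_group n)"
  shows "card (unitary_cell n ` A) \<le> (16 * n ^ 2 + 1) ^ (2 * n ^ 2)"
proof -
  let ?R = "{- int (8 * n ^ 2)..int (8 * n ^ 2)}"
  let ?E = "PiE ({..<n} \<times> {..<n}) (\<lambda>_. ?R \<times> ?R)"
  have "unitary_cell n U \<in> ?E" if U: "U \<in> A" for U
  proof -
    have "(\<lfloor>real (8 * n) * Re (U $$ (i, j))\<rfloor>, \<lfloor>real (8 * n) * Im (U $$ (i, j))\<rfloor>) \<in> ?R \<times> ?R"
      if "i < n" "j < n" for i j
    proof -
      have "cmod (U $$ (i, j)) \<le> real n" using unitary_entry_le that A U by blast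
      then have "\<bar>Re (U $$ (i, j))\<bar> \<le> real n" "\<bar>Im (U $$ (i, j))\<bar> \<le> real n"
        using abs_Re_le_cmod abs_Im_le_cmod order_trans by blast+
      then show ?thesis by (intro SigmaI floor_mult_mem)
    qed
    then show ?thesis unfolding unitary_cell_def by (intro restrict_PiE_iff[THEN iffD2]) auto
  qed
  then have "card (unitary_cell n ` A) \<le> card ?E" by (intro card_mono finite_PiE) auto
  also have "\<dots> = (card ?R * card ?R) ^ (n * n)"
    by (simp add: card_PiE card_cartesian_product)
  also have "card ?R = 16 * n ^ 2 + 1" by (simp add: nat_add_distrib nat_mult_distrib nat_power_eq)
  also have "((16 * n ^ 2 + 1) * (16 * n ^ 2 + 1)) ^ (n * n) = (16 * n ^ 2 + 1) ^ (2 * n ^ 2)"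
    by (simp only: power2_eq_square[symmetric] power_mult[symmetric])
  finally show ?thesis .
qed

lemma abs_diff_le_of_floor_eq:
  assumes "\<lfloor>real (8 * n) * x\<rfloor> = \<lfloor>real (8 * n) * y\<rfloor>" "1 \<le> n"
  shows "(x - y) ^ 2 \<le> 1 / (64 * real n ^ 2)"
proof -
  have "\<bar>real (8 * n) * x - real (8 * n) * y\<bar> < 1" using assms(1) by linarith
  then have "\<bar>real (8 * n) * (x - y)\<bar> ^ 2 \<le> 1 ^ 2" by (intro power_mono) (auto simp: right_diff_distrib)
  then have "64 * real n ^ 2 * (x - y) ^ 2 \<le> 1" by (simp add: power_mult_distrib)
  then show ?thesis using assms(2) by (simp add: field_simps)
qed

lemma unitary_cell_close:
  assumes A: "A \<in> carrier (unitary_group n)" and B: "B \<in> carrier (unitary_group n)"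
    and eq: "unitary_cell n A = unitary_cell n B" and n: "1 \<le> n"
  shows "frob_norm (A - B) \<le> 1 / 5"
proof (rule power2_le_imp_le)
  have c: "A \<in> carrier_mat n n" "B \<in> carrier_mat n n" using A B unitary_carrier_mat by blast+
  have "cmod ((A - B) $$ (i, j)) ^ 2 \<le> 2 / (64 * real n ^ 2)" if ij: "i < n" "j < n" for i j
  proof -
    have "unitary_cell n A (i, j) = unitary_cell n B (i, j)" using eq by simp
    then have "(Re (A $$ (i, j)) - Re (B $$ (i, j))) ^ 2 \<le> 1 / (64 * real n ^ 2)"
      "(Im (A $$ (i, j)) - Im (B $$ (i, j))) ^ 2 \<le> 1 / (64 * real n ^ 2)"
      using ij n by (auto simp: unitary_cell_def intro!: abs_diff_le_of_floor_eq)
    then show ?thesis using c ij by (simp add: cmod_power2)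
  qed
  then have "frob_norm (A - B) ^ 2 \<le> (\<Sum>i<n. \<Sum>j<n. 2 / (64 * real n ^ 2))"
    unfolding frob_norm_power2[OF minus_carrier_mat[OF c(2)]] by (intro sum_mono) auto
  also have "\<dots> = 1 / 32" using n by (simp add: power2_eq_square)
  also have "\<dots> \<le> (1 / 5) ^ 2" by (simp add: power2_eq_square)
  finally show "frob_norm (A - B) ^ 2 \<le> (1 / 5) ^ 2" .
qed simp

section \<open>Index bounds and the choice of constants\<close>

lemma unitary_index_abelian:
  assumes A: "approx_group (unitary_group n) K A" and n: "1 \<le> n"
  shows "\<exists>Z. subgroup Z (unitary_group n) \<and> (\<forall>x\<in>Z. \<forall>y\<in>Z. x * y = y * x) \<and>
    real (card ((\<lambda>a. a <#\<^bsub>unitary_group n\<^esub> Z) ` A)) \<le> (real (16 * n ^ 2 + 1) ^ (2 * n ^ 2) * K ^ 7) ^ n"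
proof -
  interpret contracting_group "unitary_group n" "\<lambda>x y. frob_norm (x - y)"
    by (rule contracting_unitary_group)
  obtain X where X: "sym_subset (unitary_group n) X" "finite X" "real (card X) \<le> K"
      "A <#>\<^bsub>unitary_group n\<^esub> A \<subseteq> X <#>\<^bsub>unitary_group n\<^esub> A"
    using A by (auto simp: approx_group_def)
  have A': "A \<subseteq> carrier (unitary_group n)" "finite A" "A \<noteq> {}"
    "\<And>a. a \<in> A \<Longrightarrow> inv\<^bsub>unitary_group n\<^esub> a \<in> A"
    using A by (auto simp: approx_group_def sym_subset_def)
  have XU: "X \<subseteq> carrier (unitary_group n)" using X(1) by (simp add: sym_subset_def)
  have "\<exists>Z. subgroup Z (unitary_group n) \<and>
      (\<forall>x\<in>Z. \<forall>y\<in>Z. x \<otimes>\<^bsub>unitary_group n\<^esub> y = y \<otimes>\<^bsub>unitary_group n\<^esub> x) \<and>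
      card ((\<lambda>a. a <#\<^bsub>unitary_group n\<^esub> Z) ` A) \<le> (card (unitary_cell n ` A) * card X ^ 7) ^ n"
  proof (rule index_abelian_centralizer[OF A' XU X(2,4)])
    fix a b assume "a \<in> A" "b \<in> A" "unitary_cell n a = unitary_cell n b"
    then show "frob_norm (a - b) \<le> 1 / 5" using unitary_cell_close n A'(1) by blast
  qed (use length_commuting_chain_unitary[OF _ n] in auto)
  then obtain Z where Z: "subgroup Z (unitary_group n)" "\<forall>x\<in>Z. \<forall>y\<in>Z. x * y = y * x"
    "card ((\<lambda>a. a <#\<^bsub>unitary_group n\<^esub> Z) ` A) \<le> (card (unitary_cell n ` A) * card X ^ 7) ^ n"
    unfolding unitary_group_simps by blast
  have "real (card ((\<lambda>a. a <#\<^bsub>unitary_group n\<^esub> Z) ` A))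
      \<le> (real (card (unitary_cell n ` A)) * real (card X) ^ 7) ^ n"
    using of_nat_mono[OF Z(3), where 'a = real] by simp
  also have "\<dots> \<le> (real (16 * n ^ 2 + 1) ^ (2 * n ^ 2) * K ^ 7) ^ n"
  proof (intro power_mono mult_mono X(3))
    show "real (card (unitary_cell n ` A)) \<le> real (16 * n ^ 2 + 1) ^ (2 * n ^ 2)"
      using of_nat_mono[OF card_unitary_cell[OF A'(1)], where 'a = real] by simp
  qed simp_all
  finally show ?thesis using Z(1,2) by blast
qed

lemma unitary_group_1_commute:
  assumes "x \<in> carrier (unitary_group 1)" "y \<in> carrier (unitary_group 1)"
  shows "x * y = y * x"
  using unitary_carrier_mat[OF assms(1)] unitary_carrier_mat[OF assms(2)]
  by (intro eq_matI) (auto simp: scalar_prod_def)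

text \<open>For \<open>2 \<le> n\<close> a power of \<open>n\<close> absorbs the number of cells. In
  dimension one that power is 1, but there the whole group is abelian.\<close>

lemma exists_abelian_subgroup_small_index:
  assumes A: "approx_group (unitary_group n) K A" and n: "1 \<le> n" and K: "2 \<le> K"
  shows "\<exists>Z. subgroup Z (unitary_group n) \<and> (\<forall>x\<in>Z. \<forall>y\<in>Z. x * y = y * x) \<and>
    2 * real (card ((\<lambda>a. a <#\<^bsub>unitary_group n\<^esub> Z) ` A)) \<le> real n ^ (14 * n ^ 3) * K ^ (14 * n)"
proof (cases "n = 1")
  case True
  interpret group "unitary_group n" by (rule unitary_group_is_group)
  have AU: "A \<subseteq> carrier (unitary_group n)" using A by (simp add: approx_group_def sym_subset_def)
  have "card ((\<lambda>a. a <#\<^bsub>unitary_group n\<^esub> carrier (unitary_group n)) ` A) \<le> card {()}"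
    using l_coset_eq_iff[OF subgroup_self] AU
    by (intro card_image_le_of_label[where g = "\<lambda>_. ()"]) (auto simp: subset_iff)
  then have "2 * real (card ((\<lambda>a. a <#\<^bsub>unitary_group n\<^esub> carrier (unitary_group n)) ` A)) \<le> 2" by simp
  also have "2 \<le> K ^ 14" using K power_increasing[of 1 14 K] by simp
  finally show ?thesis
    using subgroup_self unitary_group_1_commute True
    by (intro exI[of _ "carrier (unitary_group n)"]) auto
next
  case False
  then have n2: "2 \<le> n" using n by simp
  obtain Z where Z: "subgroup Z (unitary_group n)" "\<forall>x\<in>Z. \<forall>y\<in>Z. x * y = y * x"
    "real (card ((\<lambda>a. a <#\<^bsub>unitary_group n\<^esub> Z) ` A)) \<le> (real (16 * n ^ 2 + 1) ^ (2 * n ^ 2) * K ^ 7) ^ n"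
    using unitary_index_abelian[OF A n] by blast
  have "1 \<le> n ^ 2" using n by simp
  then have "16 * n ^ 2 + 1 \<le> 32 * n ^ 2" by simp
  \<comment> \<open>Here \<open>32 = 2 ^ 5 \<le> n ^ 5\<close>.\<close>
  also have "\<dots> \<le> n ^ 5 * n ^ 2" using power_mono[OF n2, of 5] by (intro mult_right_mono) simp_all
  finally have "real (16 * n ^ 2 + 1) \<le> real (n ^ 5 * n ^ 2)" by (rule of_nat_mono)
  then have "real (16 * n ^ 2 + 1) \<le> real n ^ 7" by (simp flip: power_add)
  then have "(real (16 * n ^ 2 + 1) ^ (2 * n ^ 2) * K ^ 7) ^ n \<le> ((real n ^ 7) ^ (2 * n ^ 2) * K ^ 7) ^ n"
    using K by (intro power_mono mult_right_mono) auto
  \<comment> \<open>The exponent of \<open>n\<close> is \<open>7 * (2 * n ^ 2) * n\<close>, the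
    source of the 14.\<close>
  also have "\<dots> = real n ^ (14 * n ^ 3) * K ^ (7 * n)"
    by (simp add: power_mult_distrib power_mult[symmetric] power3_eq_cube power2_eq_square mult_ac)
  finally have "2 * real (card ((\<lambda>a. a <#\<^bsub>unitary_group n\<^esub> Z) ` A)) \<le> 2 * (real n ^ (14 * n ^ 3) * K ^ (7 * n))"
    using Z(3) by linarith
  \<comment> \<open>The factor 2 costs one factor \<open>K\<close>, and
    \<open>7 * n + 1 \<le> 14 * n\<close>.\<close>
  also have "\<dots> \<le> K * (real n ^ (14 * n ^ 3) * K ^ (7 * n))" using K by (intro mult_right_mono) auto
  also have "\<dots> = real n ^ (14 * n ^ 3) * K ^ (7 * n + 1)" by simp
  also have "\<dots> \<le> real n ^ (14 * n ^ 3) * K ^ (14 * n)"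
    using K n by (intro mult_left_mono power_increasing) auto
  finally show ?thesis using Z(1,2) by blast
qed

theorem theorem1p3:
  shows "\<exists>C::real. C > 0 \<and>
    (\<forall>(n::nat) (K::real) (A :: complex mat set).
       n \<ge> 1 \<longrightarrow> K \<ge> 2 \<longrightarrow> approx_group (unitary_group n) K A \<longrightarrow>
       (\<exists>B. approx_group (unitary_group n) (K powr C) B \<and>
            simultaneously_diagonalisable B \<and>
            controlled_by (unitary_group n)
              (real n powr (C * real n ^ 3) * K powr (C * real n)) A B))"
\<comment> \<open>The 14 comes from the power of \<open>n\<close>; the powers of \<open>K\<close>
  leave room.\<close>
proof (intro exI[of _ 14] conjI allI impI)
  fix n :: nat and K :: real and A :: "complex mat set"
  assume n: "n \<ge> 1" and K: "K \<ge> 2" and A: "approx_group (unitary_group n) K A"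
  interpret group "unitary_group n" by (rule unitary_group_is_group)
  obtain Z where Z: "subgroup Z (unitary_group n)" "\<forall>x\<in>Z. \<forall>y\<in>Z. x * y = y * x"
    "2 * real (card ((\<lambda>a. a <#\<^bsub>unitary_group n\<^esub> Z) ` A)) \<le> real n ^ (14 * n ^ 3) * K ^ (14 * n)"
    using exists_abelian_subgroup_small_index[OF A n K] by blast
  define B where "B = set_power (unitary_group n) A 2 \<inter> Z"
  have L: "real n powr (14 * real n ^ 3) * K powr (14 * real n) = real n ^ (14 * n ^ 3) * K ^ (14 * n)"
    using n K powr_realpow[of "real n" "14 * n ^ 3"] powr_realpow[of K "14 * n"] by simp
  have "approx_group (unitary_group n) (2 * K ^ 3) B"
    unfolding B_def by (rule approx_group_inter_subgroup[OF A Z(1)])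
  moreover have "2 * K ^ 3 \<le> K powr 14"
  proof -
    have "2 * K ^ 3 \<le> K * K ^ 3" using K by (intro mult_right_mono) auto
    also have "\<dots> = K ^ 4" by (simp add: eval_nat_numeral)
    also have "\<dots> \<le> K ^ 14" using K by (intro power_increasing) auto
    also have "\<dots> = K powr 14" using K by simp
    finally show ?thesis .
  qed
  \<comment> \<open>The constant enters \<open>approx_group\<close> only as an upper bound for a
    cardinality, so it may be enlarged.\<close>
  ultimately have "approx_group (unitary_group n) (K powr 14) B"
    unfolding approx_group_def by (meson order_trans)
  moreover have "simultaneously_diagonalisable B"
  proof (rule simultaneously_diagonalisable_commuting_unitary)
    have "A \<subseteq> carrier (unitary_group n)" "finite A" using A by (auto simp: approx_group_def sym_subset_def)
    then show "finite B" "B \<subseteq> carrier (unitary_group n)"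
      unfolding B_def using finite_set_power set_power_closed by blast+
  qed (use Z(2) B_def in blast)
  moreover have "controlled_by (unitary_group n) (real n ^ (14 * n ^ 3) * K ^ (14 * n)) A B"
    unfolding B_def
  proof (rule controlled_by_inter_subgroup[OF A Z(1) _ Z(3)])
    have "K \<le> K ^ (14 * n)" using K n power_increasing[of 1 "14 * n" K] by simp
    also have "\<dots> \<le> real n ^ (14 * n ^ 3) * K ^ (14 * n)"
      using n K one_le_power[of "real n" "14 * n ^ 3"] by (simp add: mult_le_cancel_right1)
    finally show "K \<le> real n ^ (14 * n ^ 3) * K ^ (14 * n)" .
  qed
  ultimately show "\<exists>B. approx_group (unitary_group n) (K powr 14) B \<and> simultaneously_diagonalisable B \<and>
      controlled_by (unitary_group n) (real n powr (14 * real n ^ 3) * K powr (14 * real n)) A B"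
    unfolding L by blast
qed simp

end
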